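(* Let $H$ be an infinite-dimensional separable complex Hilbert space, let $T\in\beta_0(H)$ and let $K\in\mathcal{B}(H)$ be a finite-rank operator. Then $T+K\in\beta_0(H)$. In particular, $T+K\in\beta(H)$.
   Context: $\mathcal{B}(H)$ is the algebra of bounded linear operators on $H$. A closed subspace $M\subseteq H$ is reducing for $T\in\mathcal{B}(H)$ if $TM\subseteq M$ and $TM^\perp\subseteq M^\perp$; $\mathcal{R}_T$ denotes the collection of all reducing subspaces of $T$. For $M\in\mathcal{R}_T$ non-zero, the restriction $T|_M$ is norm attaining if there is a unit vector $x\in M$ with $\|Tx\|=\|T|_M\|$, where $\|T|_M\|=\sup\{\|Ty\|:y\in M,\|y\|=1\}$. Put $|T|:=(T^*T)^{1/2}$ and $$\beta(H):=\{T\in\mathcal{B}(H): T|_M \text{ is norm attaining for every non-zero } M\in\mathcal{R}_T\},\qquad \beta_0(H):=\{T\in\mathcal{B}(H): |T|\in\beta(H)\}.$$ *)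

theory Defs
  imports "HOL-Analysis.Analysis"
begin

section \<open>Complex Hilbert spaces\<close>

text \<open>
  A complex inner product space is presented over \<^class>\<open>real_inner\<close>: its real structure is the
  one obtained by restricting scalars, with real inner product the real part of the complex one,
  so that the norm is the square root of \<open>cinner x x\<close> and the topology is the norm topology.
  The inner product is linear in its first and conjugate-linear in its second argument.
  Positive definiteness of \<open>cinner\<close> follows from that of the real inner product, see
  \<open>cinner_self\<close>.
\<close>

class complex_inner = real_inner +
  fixes scaleC :: "complex \<Rightarrow> 'a \<Rightarrow> 'a" (infixr \<open>*\<^sub>C\<close> 75)
    and cinner :: "'a \<Rightarrow> 'a \<Rightarrow> complex"
  assumes scaleC_add_right: "a *\<^sub>C (x + y) = a *\<^sub>C x + a *\<^sub>C y"
    and scaleC_add_left: "(a + b) *\<^sub>C x = a *\<^sub>C x + b *\<^sub>C x"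
    and scaleC_scaleC: "a *\<^sub>C b *\<^sub>C x = (a * b) *\<^sub>C x"
    and scaleC_of_real: "complex_of_real r *\<^sub>C x = r *\<^sub>R x"
    and cinner_commute: "cinner x y = cnj (cinner y x)"
    and cinner_add_left: "cinner (x + y) z = cinner x z + cinner y z"
    and cinner_scaleC_left: "cinner (a *\<^sub>C x) y = a * cinner x y"
    and inner_eq_Re_cinner: "inner x y = Re (cinner x y)"

class complex_hilbert_space = complex_inner + complete_space

lemma cinner_self: "cinner x x = complex_of_real ((norm x)\<^sup>2)"
proof -
  have "Im (cinner x x) = 0"
    using cinner_commute[of x x] by (metis complex_cnj_cancel_iff Reals_cnj_iff complex_is_Real_iff)
  then show ?thesis
    by (simp add: complex_eq_iff power2_norm_eq_inner inner_eq_Re_cinner)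
qed

global_interpretation complex_vector: vector_space "scaleC :: complex \<Rightarrow> 'a \<Rightarrow> 'a::complex_inner"
  defines csubspace = complex_vector.subspace
    and cspan = complex_vector.span
proof
  show "1 *\<^sub>C x = x" for x :: 'a
    using scaleC_of_real[of 1 x] by simp
qed (simp_all add: scaleC_add_right scaleC_add_left scaleC_scaleC)

definition cfinite_dim :: "'a::complex_inner set \<Rightarrow> bool" where
  "cfinite_dim S \<longleftrightarrow> (\<exists>B. finite B \<and> cspan B = S)"

definition ortho_compl :: "'a::complex_inner set \<Rightarrow> 'a set" where
  "ortho_compl M = {x. \<forall>y\<in>M. cinner x y = 0}"


section \<open>Bounded operators\<close>

definition bounded_operators :: "('a::complex_inner \<Rightarrow> 'a) set" where
  "bounded_operators =
    {T. Vector_Spaces.linear (*\<^sub>C) (*\<^sub>C) T \<and> (\<exists>C. \<forall>x. norm (T x) \<le> C * norm x)}"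

definition finite_rank :: "('a::complex_inner \<Rightarrow> 'a) \<Rightarrow> bool" where
  "finite_rank T \<longleftrightarrow> cfinite_dim (range T)"

text \<open>
  The following three are used for bounded operators on a Hilbert space only, where the described
  objects exist and are unique (Riesz representation; positive square root).
\<close>

definition cadjoint :: "('a::complex_inner \<Rightarrow> 'a) \<Rightarrow> 'a \<Rightarrow> 'a" where
  "cadjoint T = (THE S. \<forall>x y. cinner (T x) y = cinner x (S y))"

definition positive_op :: "('a::complex_inner \<Rightarrow> 'a) \<Rightarrow> bool" where
  "positive_op P \<longleftrightarrow> P \<in> bounded_operators \<and> (\<forall>x. cinner (P x) x \<in> \<real>\<^sub>\<ge>\<^sub>0)"

definition sqrt_op :: "('a::complex_inner \<Rightarrow> 'a) \<Rightarrow> 'a \<Rightarrow> 'a" where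
  "sqrt_op A = (THE P. positive_op P \<and> P \<circ> P = A)"

definition abs_op :: "('a::complex_inner \<Rightarrow> 'a) \<Rightarrow> 'a \<Rightarrow> 'a" where
  "abs_op T = sqrt_op (cadjoint T \<circ> T)"


section \<open>Reducing subspaces and norm attainment\<close>

definition reducing_subspaces :: "('a::complex_inner \<Rightarrow> 'a) \<Rightarrow> 'a set set" where
  "reducing_subspaces T =
    {M. csubspace M \<and> closed M \<and> T ` M \<subseteq> M \<and> T ` ortho_compl M \<subseteq> ortho_compl M}"

definition restr_norm :: "('a::complex_inner \<Rightarrow> 'a) \<Rightarrow> 'a set \<Rightarrow> real" where
  "restr_norm T M = (SUP y\<in>{y \<in> M. norm y = 1}. norm (T y))"

definition norm_attaining_on :: "('a::complex_inner \<Rightarrow> 'a) \<Rightarrow> 'a set \<Rightarrow> bool" where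
  "norm_attaining_on T M \<longleftrightarrow> (\<exists>x\<in>M. norm x = 1 \<and> norm (T x) = restr_norm T M)"

definition beta :: "('a::complex_hilbert_space \<Rightarrow> 'a) set" where
  "beta = {T \<in> bounded_operators.
    \<forall>M \<in> reducing_subspaces T. M \<noteq> {0} \<longrightarrow> norm_attaining_on T M}"

definition beta0 :: "('a::complex_hilbert_space \<Rightarrow> 'a) set" where
  "beta0 = {T \<in> bounded_operators. abs_op T \<in> beta}"

end

theory Submission
  imports Defs
begin

text \<open>
  The property \<open>P \<in> beta\<close> of a positive operator \<open>P\<close> says that the spectrum of \<open>P\<^sup>2\<close> does not accumulate
  at any point from below. A finite-rank perturbation \<open>S = T + K\<close> changes \<open>T\<^sup>* T\<close> to \<open>S\<^sup>* S\<close>, which still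
  agrees with \<open>T\<^sup>* T\<close> on a subspace of finite codimension; this can put only finitely many eigenvalues
  into a spectral gap, so \<open>S\<^sup>* S\<close> has no accumulation from below either, and the norm of
  \<open>\<bar>S\<bar>\<close> on a subspace that it leaves invariant, being an upper end of a spectrum, is attained.

  The proof follows this idea without the spectral theorem. All the analysis takes place in a real
  Hilbert space. The tool is the positive square root, together with the fact that it commutes with the
  commutant (\<open>sqrt_exists\<close>). It splits the space into the nonnegative and the negative part of a
  self-adjoint operator (\<open>sign_splitting\<close>). Applied to \<open>P\<^sup>2 - \<mu>\<close>, norm attainment on the negative part gives
  the gap below \<open>\<mu>\<close>, in the form of a quadratic operator inequality (\<open>spectral_gap_below\<close>). If \<open>Q = \<bar>S\<bar>\<close> did
  not attain its norm \<open>s\<close> on an invariant \<open>M\<close>, the root \<open>R\<close> of \<open>s\<^sup>2 - Q\<^sup>2\<close> would be injective on \<open>M\<close>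
  without being bounded below. But the gap below \<open>s\<^sup>2\<close>, which holds for \<open>Q\<^sup>2\<close> on a part of \<open>M\<close> of finite
  codimension, makes \<open>R\<close> bounded below on the image under \<open>R\<close> of that part, finitely many dimensions
  can be added back one at a time, and the range of \<open>R\<close> is dense in \<open>M\<close>
  (\<open>finite_codim_perturbation_attains_norm\<close>).

  Complex scalars enter only at the end: real adjoints and square roots of complex linear operators are
  complex linear because they commute with multiplication by \<open>\<i>\<close>. The conclusion for \<open>S\<close> itself follows from
  the one for \<open>\<bar>S\<bar>\<close>, as \<open>\<parallel>S x\<parallel> = \<parallel>\<bar>S\<bar> x\<parallel>\<close> and reducing subspaces of \<open>S\<close> are invariant under \<open>\<bar>S\<bar>\<close>.
\<close>

section \<open>Projections and adjoints in real Hilbert space\<close>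

text \<open>
  Minimise \<open>\<parallel>x\<parallel>\<^sup>2 - 2 f x\<close> over \<open>M\<close>: the parallelogram law makes minimising sequences Cauchy, and
  the derivative vanishes at the minimiser. With \<open>f = (\<bullet>) z\<close> this gives the orthogonal projection
  of \<open>z\<close> to \<open>M\<close>, with \<open>M\<close> the whole space it gives the representation theorem behind adjoints.
\<close>

lemma riesz_on_closed_subspace:
  fixes f :: "'a::{real_inner,banach} \<Rightarrow> real"
  assumes f: "bounded_linear f" and M: "subspace M" "closed M"
  obtains p where "p \<in> M" and "\<And>m. m \<in> M \<Longrightarrow> p \<bullet> m = f m"
proof -
  interpret f: bounded_linear f by fact
  define J where "J x = x \<bullet> x - 2 * f x" for x
  obtain k where k: "k > 0" "\<And>x. norm (f x) \<le> norm x * k"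
    using f.pos_bounded by blast
  have lower: "- k\<^sup>2 \<le> J x" for x
  proof -
    have "f x \<le> norm x * k"
      using k(2)[of x] by simp
    moreover have "0 \<le> (norm x - k)\<^sup>2"
      by simp
    ultimately show ?thesis
      by (simp add: J_def power2_norm_eq_inner[symmetric] power2_diff)
  qed
  define d where "d = (INF x\<in>M. J x)"
  have bdd: "bdd_below (J ` M)"
    using lower by (meson bdd_belowI2)
  have d_le: "d \<le> J x" if "x \<in> M" for x
    unfolding d_def using bdd that by (rule cINF_lower)
  have "\<exists>x\<in>M. J x < d + 1 / real (Suc n)" for n
  proof -
    have "M \<noteq> {}" using M(1) subspace_0 by blast
    moreover have "d < d + 1 / real (Suc n)" by simp
    ultimately show ?thesis
      unfolding d_def using cINF_less_iff[of M J] bdd by blast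
  qed
  then obtain X where X: "\<And>n. X n \<in> M" "\<And>n. J (X n) < d + 1 / real (Suc n)"
    by metis
  have close: "(dist x y)\<^sup>2 \<le> 2 * (J x - d) + 2 * (J y - d)" if "x \<in> M" "y \<in> M" for x y
  proof -
    have "(1/2) *\<^sub>R (x + y) \<in> M"
      using that M(1) by (simp add: subspace_add subspace_scale)
    from d_le[OF this]
    have "d \<le> (1/4) * ((x + y) \<bullet> (x + y)) - (f x + f y)"
      by (simp add: J_def f.add f.scaleR inner_add algebra_simps)
    moreover have "(dist x y)\<^sup>2 = 2 * (x \<bullet> x) + 2 * (y \<bullet> y) - (x + y) \<bullet> (x + y)"
      by (simp add: dist_norm power2_norm_eq_inner inner_add inner_diff inner_commute algebra_simps)
    ultimately show ?thesis by (simp add: J_def)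
  qed
  have "Cauchy X"
  proof (rule metric_CauchyI)
    fix e :: real assume "e > 0"
    obtain N where N: "1 / real (Suc N) < e\<^sup>2 / 4"
      using \<open>e > 0\<close> by (metis nat_approx_posE divide_pos_pos zero_less_numeral zero_less_power)
    have near: "J (X k) < d + e\<^sup>2 / 4" if "k \<ge> N" for k
    proof -
      have "1 / real (Suc k) \<le> 1 / real (Suc N)"
        using that by (auto intro!: divide_left_mono)
      also note N
      finally show ?thesis using X(2)[of k] by (meson add_strict_left_mono less_trans)
    qed
    have "dist (X m) (X n) < e" if "m \<ge> N" "n \<ge> N" for m n
    proof -
      have "(dist (X m) (X n))\<^sup>2 < e\<^sup>2"
        using close[OF X(1) X(1), of m n] near[OF that(1)] near[OF that(2)] by argo
      then show ?thesis using \<open>e > 0\<close> by (simp add: power_less_imp_less_base)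
    qed
    then show "\<exists>N. \<forall>m\<ge>N. \<forall>n\<ge>N. dist (X m) (X n) < e" by blast
  qed
  then obtain p where p: "X \<longlonglongrightarrow> p"
    by (auto simp: Cauchy_convergent_iff convergent_def)
  have "p \<in> M"
    using M(2) X(1) p by (auto simp: closed_sequential_limits)
  have "J p \<le> d"
  proof (rule LIMSEQ_le)
    show "(\<lambda>n. J (X n)) \<longlonglongrightarrow> J p"
      unfolding J_def by (intro tendsto_intros p f.tendsto)
    show "(\<lambda>n. d + 1 / real (Suc n)) \<longlonglongrightarrow> d"
      using tendsto_add[OF tendsto_const[of d] LIMSEQ_inverse_real_of_nat]
      by (simp add: inverse_eq_divide)
    show "\<exists>N. \<forall>n\<ge>N. J (X n) \<le> d + 1 / real (Suc n)"
      using X(2) less_imp_le by blast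
  qed
  have "p \<bullet> m = f m" if "m \<in> M" for m
  proof (cases "m = 0")
    case True then show ?thesis by (simp add: f.zero)
  next
    case False
    define a where "a = p \<bullet> m - f m"
    define t where "t = - a / (m \<bullet> m)"
    have "p + t *\<^sub>R m \<in> M"
      using \<open>p \<in> M\<close> that M(1) by (simp add: subspace_add subspace_scale)
    with d_le \<open>J p \<le> d\<close> have "J p \<le> J (p + t *\<^sub>R m)" by fastforce
    also have "\<dots> = J p + 2 * t * a + t * t * (m \<bullet> m)"
      by (simp add: J_def a_def f.add f.scaleR inner_add inner_commute algebra_simps)
    also have "\<dots> = J p - a\<^sup>2 / (m \<bullet> m)"
      using False by (simp add: t_def field_simps power2_eq_square)
    finally have "a\<^sup>2 / (m \<bullet> m) \<le> 0" by simp
    moreover have "0 < m \<bullet> m" using False by simp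
    ultimately have "a\<^sup>2 \<le> 0" by (simp add: divide_le_0_iff)
    then show ?thesis by (simp add: a_def)
  qed
  with \<open>p \<in> M\<close> show thesis by (rule that)
qed

text \<open>
  The complement for the real inner product. It agrees with \<^const>\<open>ortho_compl\<close> on complex
  subspaces (\<open>ortho_compl_eq_orth\<close>).
\<close>

definition orth :: "'a::real_inner set \<Rightarrow> 'a set" where
  "orth M = {x. \<forall>y\<in>M. x \<bullet> y = 0}"

lemma subspace_orth: "subspace (orth M)"
  by (auto simp: subspace_def orth_def inner_add)

lemma closed_orth: "closed (orth M)"
proof -
  have "orth M = (\<Inter>y\<in>M. {x. x \<bullet> y = 0})"
    by (auto simp: orth_def)
  also have "closed \<dots>"
    by (intro closed_INT ballI closed_Collect_eq continuous_intros)
  finally show ?thesis .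
qed

lemma orth_decomposition:
  fixes x :: "'a::{real_inner,banach}"
  assumes "subspace M" "closed M"
  obtains m n where "m \<in> M" "n \<in> orth M" "x = m + n"
proof -
  obtain p where p: "p \<in> M" "\<And>m. m \<in> M \<Longrightarrow> p \<bullet> m = x \<bullet> m"
    using riesz_on_closed_subspace[OF bounded_linear_inner_right assms] by blast
  then have "x - p \<in> orth M"
    by (simp add: orth_def inner_diff)
  with p(1) show thesis
    using that[of p "x - p"] by simp
qed

lemma orth_orth:
  fixes M :: "'a::{real_inner,banach} set"
  assumes "subspace M" "closed M"
  shows "orth (orth M) = M"
proof
  show "M \<subseteq> orth (orth M)"
    by (auto simp: orth_def inner_commute)
  show "orth (orth M) \<subseteq> M"
  proof
    fix x assume x: "x \<in> orth (orth M)"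
    obtain m n where mn: "m \<in> M" "n \<in> orth M" "x = m + n"
      using orth_decomposition[OF assms] by blast
    then have "x \<bullet> n = 0" "m \<bullet> n = 0"
      using x by (auto simp: orth_def inner_commute)
    with mn show "x \<in> M" by (simp add: inner_add)
  qed
qed

lemma real_adjoint_exists:
  fixes f :: "'a::{real_inner,banach} \<Rightarrow> 'a"
  assumes "bounded_linear f"
  obtains g where "bounded_linear g" and "\<And>x y. f x \<bullet> y = x \<bullet> g y"
proof -
  interpret f: bounded_linear f by fact
  have "\<exists>p. \<forall>x. f x \<bullet> y = x \<bullet> p" for y
  proof -
    have "bounded_linear (\<lambda>x. f x \<bullet> y)"
      by (rule bounded_linear_inner_left_comp[OF assms])
    then obtain p where "\<And>m. p \<bullet> m = f m \<bullet> y"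
      using riesz_on_closed_subspace[of "\<lambda>x. f x \<bullet> y" UNIV] by auto
    then show ?thesis by (metis inner_commute)
  qed
  then obtain g where g: "\<And>x y. f x \<bullet> y = x \<bullet> g y" by metis
  have eqI: "u = v" if "\<And>x. x \<bullet> u = x \<bullet> v" for u v :: 'a
    using that vector_eq_ldot[of u v] by simp
  obtain k where k: "\<And>x. norm (f x) \<le> norm x * k" "k > 0"
    using f.pos_bounded by blast
  have "bounded_linear g"
  proof (rule bounded_linear_intro)
    show "g (x + y) = g x + g y" for x y
      by (rule eqI) (simp add: inner_add flip: g)
    show "g (r *\<^sub>R x) = r *\<^sub>R g x" for r x
      by (rule eqI) (simp flip: g)
    show "norm (g x) \<le> norm x * k" for x
    proof (cases "g x = 0")
      case False
      have "(norm (g x))\<^sup>2 = f (g x) \<bullet> x"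
        by (simp add: power2_norm_eq_inner g)
      also have "\<dots> \<le> norm (f (g x)) * norm x"
        by (rule norm_cauchy_schwarz)
      also have "\<dots> \<le> norm (g x) * k * norm x"
        by (intro mult_right_mono k) simp
      finally show ?thesis using False by (simp add: power2_eq_square mult_ac)
    qed (use k in simp)
  qed
  with g show thesis by (rule that[rotated])
qed

section \<open>Positive operators and their square roots\<close>

definition self_adjoint :: "('a::real_inner \<Rightarrow> 'a) \<Rightarrow> bool" where
  "self_adjoint f \<longleftrightarrow> bounded_linear f \<and> (\<forall>x y. f x \<bullet> y = x \<bullet> f y)"

definition pos_semidef :: "('a::real_inner \<Rightarrow> 'a) \<Rightarrow> bool" where
  "pos_semidef f \<longleftrightarrow> self_adjoint f \<and> (\<forall>x. 0 \<le> f x \<bullet> x)"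

lemma self_adjointD:
  "self_adjoint f \<Longrightarrow> bounded_linear f"
  "self_adjoint f \<Longrightarrow> f x \<bullet> y = x \<bullet> f y"
  by (auto simp: self_adjoint_def)

lemma pos_semidefD:
  "pos_semidef f \<Longrightarrow> self_adjoint f"
  "pos_semidef f \<Longrightarrow> 0 \<le> f x \<bullet> x"
  by (auto simp: pos_semidef_def)

text \<open>
  Evaluate the nonnegative form of \<open>f\<close> at \<open>x - (1/c) f x\<close>. This takes the place of the
  Cauchy-Schwarz inequality for the form \<open>f x \<bullet> y\<close>.
\<close>

lemma pos_semidef_norm_square_le:
  assumes f: "pos_semidef f" and c: "c > 0" "\<And>y. f y \<bullet> y \<le> c * (norm y)\<^sup>2"
  shows "(norm (f x))\<^sup>2 \<le> c * (f x \<bullet> x)"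
proof -
  interpret bounded_linear f
    using f by (simp add: pos_semidef_def self_adjoint_def)
  have sym: "f (f x) \<bullet> x = f x \<bullet> f x"
    using f by (simp add: pos_semidef_def self_adjoint_def)
  have "0 \<le> f (x - (1/c) *\<^sub>R f x) \<bullet> (x - (1/c) *\<^sub>R f x)"
    using f by (simp add: pos_semidef_def)
  also have "\<dots> = f x \<bullet> x - 2 / c * (f x \<bullet> f x) + (1 / c)\<^sup>2 * (f (f x) \<bullet> f x)"
    by (simp add: diff scaleR inner_diff sym power2_eq_square algebra_simps)
  also have "\<dots> \<le> f x \<bullet> x - 2 / c * (f x \<bullet> f x) + (1 / c)\<^sup>2 * (c * (norm (f x))\<^sup>2)"
    by (intro add_left_mono mult_left_mono c) simp
  also have "\<dots> = f x \<bullet> x - (norm (f x))\<^sup>2 / c"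
    using c(1) unfolding power2_norm_eq_inner by (simp add: power2_eq_square field_simps)
  finally show ?thesis using c(1) by (simp add: field_simps)
qed

lemma pos_semidef_form_eq_0D:
  assumes f: "pos_semidef f" and "f x \<bullet> x = 0"
  shows "f x = 0"
proof -
  interpret bounded_linear f
    using f by (simp add: pos_semidef_def self_adjoint_def)
  obtain k where k: "k > 0" "\<And>x. norm (f x) \<le> norm x * k"
    using pos_bounded by blast
  have "f y \<bullet> y \<le> k * (norm y)\<^sup>2" for y
    using norm_cauchy_schwarz[of "f y" y] mult_right_mono[OF k(2)[of y], of "norm y"]
    by (simp add: power2_eq_square mult_ac)
  from pos_semidef_norm_square_le[OF f k(1) this, of x] show ?thesis
    using assms(2) by simp
qed

definition commutes :: "('a \<Rightarrow> 'a) \<Rightarrow> ('a \<Rightarrow> 'a) \<Rightarrow> bool" where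
  "commutes f g \<longleftrightarrow> (\<forall>x. f (g x) = g (f x))"

lemma pos_semidef_contraction:
  assumes "pos_semidef f" "\<And>x. f x \<bullet> x \<le> (norm x)\<^sup>2"
  shows "norm (f x) \<le> norm x"
proof -
  have "(norm (f x))\<^sup>2 \<le> f x \<bullet> x"
    using pos_semidef_norm_square_le[of f 1 x] assms by simp
  also have "\<dots> \<le> (norm x)\<^sup>2" by (rule assms)
  finally show ?thesis by (rule power2_le_imp_le) simp
qed

text \<open>
  This scalar sequence majorises the iteration that produces square roots of operators.
\<close>

lemma sqrt_iteration_scalar:
  defines "s \<equiv> rec_nat (0::real) (\<lambda>_ t. (1 + t\<^sup>2) / 2)"
  shows "0 \<le> s n" "s n \<le> 1" "s n \<le> s (Suc n)"
proof -
  have bounds: "0 \<le> s n \<and> s n \<le> 1" for n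
    by (induction n) (auto simp: s_def power_le_one)
  then show "0 \<le> s n" "s n \<le> 1" by auto
  have "s (Suc n) - s n = (1 - s n)\<^sup>2 / 2"
    by (simp add: s_def power2_diff field_simps)
  then show "s n \<le> s (Suc n)"
    by (metis diff_ge_0_iff_ge zero_le_divide_iff zero_le_numeral zero_le_power2)
qed

text \<open>
  The square root of \<open>1 - C\<close> is \<open>1 - X\<close>, where \<open>X = (C + X\<^sup>2) / 2\<close> is found by iteration. Starting
  from \<open>0\<close>, the operator iterates are dominated in norm, and so are their increments, by the
  iterates for the scalar \<open>1\<close> in place of \<open>C\<close>. These increase to a limit, so the operator iterates
  form a Cauchy sequence in norm even if \<open>C\<close> has norm \<open>1\<close>.
\<close>

lemma sqrt_iteration_fixpoint:
  fixes C :: "'a::{real_inner,banach} \<Rightarrow>\<^sub>L 'a"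
  assumes norm_C: "norm C \<le> 1" and sym: "self_adjoint (blinfun_apply C)"
  obtains X where "norm X \<le> 1" "self_adjoint (blinfun_apply X)" "\<And>x. 2 *\<^sub>R X x = C x + X (X x)"
    "\<And>Y. bounded_linear Y \<Longrightarrow> commutes Y (blinfun_apply C) \<Longrightarrow> commutes Y (blinfun_apply X)"
proof -
  define s where "s = rec_nat (0::real) (\<lambda>_ t. (1 + t\<^sup>2) / 2)"
  define X where "X = rec_nat 0 (\<lambda>_ Z. (1/2) *\<^sub>R (C + (Z o\<^sub>L Z)))"
  have s_simps: "s 0 = 0" "s (Suc n) = (1 + (s n)\<^sup>2) / 2" for n
    by (simp_all add: s_def)
  have X_simps: "X 0 = 0" "X (Suc n) = (1/2) *\<^sub>R (C + (X n o\<^sub>L X n))" for n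
    by (simp_all add: X_def)
  note s = sqrt_iteration_scalar[folded s_def]
  have norm_X: "norm (X n) \<le> s n" for n
  proof (induction n)
    case 0 show ?case by (simp add: X_simps s_simps)
  next
    case (Suc n)
    have "norm (C + (X n o\<^sub>L X n)) \<le> norm C + norm (X n) * norm (X n)"
      using norm_triangle_ineq[of C "(X n o\<^sub>L X n)"] norm_blinfun_compose[of "X n" "X n"] by linarith
    also have "\<dots> \<le> 1 + s n * s n"
      by (intro add_mono mult_mono norm_C Suc s) auto
    finally show ?case by (simp add: X_simps s_simps power2_eq_square)
  qed
  have step: "norm (X (Suc n) - X n) \<le> s (Suc n) - s n" for n
  proof (induction n)
    case 0
    show ?case using norm_X[of "Suc 0"] by (simp add: X_simps(1) s_simps(1))
  next
    case (Suc n)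
    let ?D = "X (Suc n) - X n" and ?d = "s (Suc n) - s n"
    have "X (Suc (Suc n)) - X (Suc n) = (1/2) *\<^sub>R ((X (Suc n) o\<^sub>L X (Suc n)) - (X n o\<^sub>L X n))"
      by (simp add: X_simps(2) algebra_simps flip: scaleR_diff_right)
    also have "(X (Suc n) o\<^sub>L X (Suc n)) - (X n o\<^sub>L X n) = (X (Suc n) o\<^sub>L ?D) + (?D o\<^sub>L X n)"
      by (rule blinfun_eqI) (simp add: blinfun.bilinear_simps)
    finally have "norm (X (Suc (Suc n)) - X (Suc n)) = (1/2) * norm ((X (Suc n) o\<^sub>L ?D) + (?D o\<^sub>L X n))"
      by simp
    also have "\<dots> \<le> (1/2) * (norm (X (Suc n)) * norm ?D + norm ?D * norm (X n))"
      by (intro mult_left_mono order.trans[OF norm_triangle_ineq] add_mono norm_blinfun_compose) simp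
    also have "\<dots> \<le> (1/2) * (s (Suc n) * ?d + ?d * s n)"
      by (intro mult_left_mono add_mono mult_mono norm_X Suc s) (use s(3)[of n] in auto)
    also have "\<dots> = s (Suc (Suc n)) - s (Suc n)"
      by (simp add: s_simps(2)[of "Suc n"] power2_eq_square algebra_simps) (simp add: s_simps field_simps power2_eq_square)
    finally show ?case .
  qed
  have "incseq s" using s(3) by (rule incseq_SucI)
  then obtain l where "s \<longlonglongrightarrow> l"
    using incseq_convergent[of s 1] s(2) by blast
  then have "summable (\<lambda>n. s (Suc n) - s n)"
    using telescope_summable by blast
  then have "summable (\<lambda>n. X (Suc n) - X n)"
    by (rule summable_comparison_test'[where N = 0]) (use step in auto)
  then have "convergent (\<lambda>n. \<Sum>k<n. X (Suc k) - X k)"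
    by (simp add: summable_iff_convergent)
  then obtain Z where Z: "X \<longlonglongrightarrow> Z"
    by (auto simp: sum_lessThan_telescope X_simps(1) convergent_def)
  have Z_apply: "(\<lambda>n. X n x) \<longlonglongrightarrow> Z x" for x
    by (intro tendsto_intros Z)
  show thesis
  proof (rule that)
    have "norm (X n) \<le> 1" for n
      using norm_X[of n] s(2)[of n] by linarith
    then show "norm Z \<le> 1"
      by (intro LIMSEQ_le_const2[OF tendsto_norm[OF Z]]) simp
    have "X n x \<bullet> y = x \<bullet> X n y" for n x y
    proof (induction n arbitrary: x y)
      case (Suc n)
      then show ?case using sym
        by (simp add: X_simps(2) self_adjoint_def blinfun.bilinear_simps inner_add)
    qed (simp add: X_simps(1))
    then have "Z x \<bullet> y = x \<bullet> Z y" for x y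
      using tendsto_inner[OF Z_apply[of x] tendsto_const[of y]]
        tendsto_inner[OF tendsto_const[of x] Z_apply[of y]]
      by (simp add: LIMSEQ_unique)
    then show "self_adjoint (blinfun_apply Z)"
      by (simp add: self_adjoint_def blinfun.bounded_linear_right)
    have "(\<lambda>n. X (Suc n)) \<longlonglongrightarrow> (1/2) *\<^sub>R (C + (Z o\<^sub>L Z))"
      unfolding X_simps(2)
      by (intro tendsto_intros Z bounded_bilinear.tendsto[OF bounded_bilinear_blinfun_compose])
    with Z have "Z = (1/2) *\<^sub>R (C + (Z o\<^sub>L Z))"
      by (metis LIMSEQ_Suc LIMSEQ_unique)
    then have half: "Z x = (1/2) *\<^sub>R (C x + Z (Z x))" for x
      by (metis blinfun_apply_blinfun_compose plus_blinfun.rep_eq scaleR_blinfun.rep_eq)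
    show "2 *\<^sub>R Z x = C x + Z (Z x)" for x
    proof -
      have "2 *\<^sub>R Z x = 2 *\<^sub>R ((1/2) *\<^sub>R (C x + Z (Z x)))"
        by (rule arg_cong[OF half])
      then show ?thesis by simp
    qed
    fix Y :: "'a \<Rightarrow> 'a" assume Y: "bounded_linear Y" "commutes Y (blinfun_apply C)"
    interpret Y: bounded_linear Y by fact
    have "Y (X n x) = X n (Y x)" for n x
    proof (induction n arbitrary: x)
      case (Suc n)
      then show ?case using Y(2)
        by (simp add: X_simps(2) commutes_def blinfun.bilinear_simps Y.add Y.scaleR)
    qed (simp add: X_simps(1) Y.zero)
    then show "commutes Y (blinfun_apply Z)"
      using LIMSEQ_unique[OF Y.tendsto[OF Z_apply] ] Z_apply by (auto simp: commutes_def)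
  qed
qed

text \<open>
  After division by a bound \<open>k\<close> of \<open>A\<close>, both \<open>A/k\<close> and \<open>1 - A/k\<close> are positive contractions and the
  iteration applies. That the root commutes with everything that commutes with \<open>A\<close> is what later
  makes it complex linear, unique, and compatible with reducing subspaces.
\<close>

lemma sqrt_exists:
  fixes A :: "'a::{real_inner,banach} \<Rightarrow> 'a"
  assumes A: "pos_semidef A"
  obtains R where "pos_semidef R" "\<And>x. R (R x) = A x"
    "\<And>Y. bounded_linear Y \<Longrightarrow> commutes Y A \<Longrightarrow> commutes Y R"
proof -
  interpret A: bounded_linear A
    using A by (simp add: pos_semidef_def self_adjoint_def)
  obtain k where k: "k > 0" "\<And>x. norm (A x) \<le> norm x * k"
    using A.pos_bounded by blast
  have A_le: "A x \<bullet> x \<le> k * (norm x)\<^sup>2" for x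
    using norm_cauchy_schwarz[of "A x" x] mult_right_mono[OF k(2)[of x], of "norm x"]
    by (simp add: power2_eq_square mult_ac)
  define c where "c x = x - (1/k) *\<^sub>R A x" for x
  have blc: "bounded_linear c"
    unfolding c_def by (intro bounded_linear_intros A.bounded_linear_axioms)
  have c: "pos_semidef c"
    using blc A A_le k(1)
    by (auto simp: pos_semidef_def self_adjoint_def c_def inner_diff power2_norm_eq_inner field_simps)
  have "c x \<bullet> x \<le> (norm x)\<^sup>2" for x
    using A k(1) by (simp add: c_def inner_diff pos_semidef_def power2_norm_eq_inner)
  then have c_contr: "norm (c x) \<le> norm x" for x
    by (rule pos_semidef_contraction[OF c])
  define C where "C = Blinfun c"
  have C: "blinfun_apply C = c"
    by (simp add: C_def bounded_linear_Blinfun_apply blc)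
  have "norm C \<le> 1"
    by (rule norm_blinfun_bound) (simp_all add: C c_contr)
  then obtain X where X: "norm X \<le> 1" "self_adjoint (blinfun_apply X)"
      "\<And>x. 2 *\<^sub>R X x = C x + X (X x)"
      "\<And>Y. bounded_linear Y \<Longrightarrow> commutes Y (blinfun_apply C) \<Longrightarrow> commutes Y (blinfun_apply X)"
    using sqrt_iteration_fixpoint[of C] c by (auto simp: C pos_semidef_def)
  define R where "R x = sqrt k *\<^sub>R (x - X x)" for x
  show thesis
  proof (rule that)
    have "bounded_linear R"
      unfolding R_def by (intro bounded_linear_intros blinfun.bounded_linear_right)
    moreover have "X x \<bullet> x \<le> x \<bullet> x" for x
    proof -
      have "X x \<bullet> x \<le> norm (X x) * norm x" by (rule norm_cauchy_schwarz)
      also have "\<dots> \<le> (1 * norm x) * norm x"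
        by (intro mult_right_mono order.trans[OF norm_blinfun] X) auto
      finally show ?thesis by (simp add: power2_eq_square flip: power2_norm_eq_inner)
    qed
    ultimately show "pos_semidef R"
      using X(2) k(1) by (auto simp: pos_semidef_def self_adjoint_def R_def inner_diff)
    show "R (R x) = A x" for x
    proof -
      have "R (R x) = k *\<^sub>R (x - 2 *\<^sub>R X x + X (X x))"
        using k(1) by (simp add: R_def blinfun.bilinear_simps algebra_simps scaleR_2)
      also have "\<dots> = k *\<^sub>R (x - c x)"
        by (simp add: X(3) C)
      also have "\<dots> = A x"
        using k(1) by (simp add: c_def)
      finally show ?thesis .
    qed
    fix Y :: "'a \<Rightarrow> 'a" assume Y: "bounded_linear Y" "commutes Y A"
    interpret Y: bounded_linear Y by fact
    have "commutes Y (blinfun_apply C)"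
      using Y(2) by (simp add: C c_def commutes_def Y.diff Y.scaleR)
    with Y(1) have "commutes Y (blinfun_apply X)" by (rule X(4))
    then show "commutes Y R"
      by (simp add: commutes_def R_def Y.diff Y.scaleR)
  qed
qed

text \<open>
  For \<open>y = (P - R) x\<close> one has \<open>(P + R) y = P\<^sup>2 x - R\<^sup>2 x = 0\<close>, so both positive forms vanish at \<open>y\<close> and
  \<open>P y = R y = 0\<close>; then \<open>\<parallel>y\<parallel>\<^sup>2 = x \<bullet> (P - R) y = 0\<close>.
\<close>

lemma sqrt_unique:
  assumes P: "pos_semidef P" and R: "pos_semidef R"
    and sq: "\<And>x. P (P x) = R (R x)" and comm: "commutes P R"
  shows "P = R"
proof
  fix x
  interpret P: bounded_linear P using P by (simp add: pos_semidef_def self_adjoint_def)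
  interpret R: bounded_linear R using R by (simp add: pos_semidef_def self_adjoint_def)
  define y where "y = P x - R x"
  have "P y + R y = 0"
    using comm sq by (simp add: y_def P.diff R.diff commutes_def)
  then have "P y \<bullet> y + R y \<bullet> y = 0"
    by (simp flip: inner_add_left)
  then have "P y \<bullet> y = 0" "R y \<bullet> y = 0"
    using pos_semidefD(2)[OF P, of y] pos_semidefD(2)[OF R, of y] by linarith+
  then have "P y = 0" "R y = 0"
    using pos_semidef_form_eq_0D P R by blast+
  then have "x \<bullet> (P y - R y) = 0" by simp
  moreover have "x \<bullet> (P y - R y) = y \<bullet> y"
    using P R by (simp add: pos_semidef_def self_adjoint_def y_def inner_diff P.diff R.diff)
  ultimately show "P x = R x" by (simp add: y_def)
qed

section \<open>Spectral splitting and gaps\<close>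

text \<open>
  Invariance under the whole commutant of \<open>P\<close>, in place of mere invariance under \<open>P\<close>, keeps track of
  complex scalars: multiplication by \<open>\<i>\<close> commutes with a complex linear \<open>P\<close>, so such an \<open>N\<close> is a
  complex subspace.
\<close>

definition hyperinvariant :: "('a::real_inner \<Rightarrow> 'a) \<Rightarrow> 'a set \<Rightarrow> bool" where
  "hyperinvariant P N \<longleftrightarrow> subspace N \<and> closed N \<and>
    (\<forall>Y. bounded_linear Y \<longrightarrow> commutes Y P \<longrightarrow> Y ` N \<subseteq> N)"

text \<open>
  Norm attainment without a supremum; equivalent to \<^const>\<open>norm_attaining_on\<close> for bounded operators
  and subspaces (\<open>norm_attaining_on_iff\<close>).
\<close>

definition attains_norm :: "('a::real_inner \<Rightarrow> 'a) \<Rightarrow> 'a set \<Rightarrow> bool" where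
  "attains_norm P M \<longleftrightarrow> (\<exists>x\<in>M. norm x = 1 \<and> (\<forall>y\<in>M. norm (P y) \<le> norm (P x) * norm y))"

lemma self_adjoint_orth_invariant:
  assumes "self_adjoint f" "f ` N \<subseteq> N"
  shows "f ` orth N \<subseteq> orth N"
  using assms by (auto simp: orth_def self_adjoint_def)

lemma self_adjoint_square: "self_adjoint f \<Longrightarrow> pos_semidef (\<lambda>x. f (f x))"
  unfolding pos_semidef_def
proof (intro conjI allI)
  assume f: "self_adjoint f"
  show "self_adjoint (\<lambda>x. f (f x))"
    using f by (simp add: self_adjoint_def bounded_linear_compose)
  show "0 \<le> f (f x) \<bullet> x" for x
    using self_adjointD(2)[OF f, of "f x" x] by simp
qed

text \<open>
  This replaces the spectral theorem: \<open>N\<close> plays the part of the spectral subspace of \<open>G\<close> for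
  \<open>[0, \<infinity>)\<close>. With \<open>R = sqrt (G\<^sup>2)\<close> put \<open>N = ker (R - G)\<close>. As \<open>(R - G) (R + G) = 0\<close>, the operator \<open>R + G\<close>
  maps into \<open>N\<close>; it also leaves the complement of \<open>N\<close> invariant, so it vanishes there and \<open>G = - R\<close>.
\<close>

lemma sign_splitting:
  fixes G :: "'a::{real_inner,banach} \<Rightarrow> 'a"
  assumes G: "self_adjoint G"
  obtains N where "hyperinvariant G N" "\<And>x. x \<in> N \<Longrightarrow> 0 \<le> G x \<bullet> x"
    "\<And>x. x \<in> orth N \<Longrightarrow> x \<noteq> 0 \<Longrightarrow> G x \<bullet> x < 0"
proof -
  interpret G: bounded_linear G using G by (rule self_adjointD)
  obtain R where R: "pos_semidef R" "\<And>x. R (R x) = G (G x)"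
      "\<And>Y. bounded_linear Y \<Longrightarrow> commutes Y (\<lambda>x. G (G x)) \<Longrightarrow> commutes Y R"
    using sqrt_exists[OF self_adjoint_square[OF G]] by blast
  have R_comm: "commutes Y R" if "bounded_linear Y" "commutes Y G" for Y
    using that by (intro R(3)) (auto simp: commutes_def)
  interpret R: bounded_linear R using R(1) by (intro self_adjointD pos_semidefD)
  define N where "N = {x. G x = R x}"
  have GR: "G (R x) = R (G x)" for x
    using R_comm[OF G.bounded_linear_axioms] by (simp add: commutes_def)
  have sub: "subspace N"
    by (auto simp: N_def subspace_def G.zero R.zero G.add R.add G.scaleR R.scaleR)
  have hyper: "Y ` N \<subseteq> N" if "bounded_linear Y" "commutes Y G" for Y
  proof
    fix z assume "z \<in> Y ` N"
    then obtain x where "z = Y x" "G x = R x" by (auto simp: N_def)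
    moreover have "Y (G x) = G (Y x)" "Y (R x) = R (Y x)"
      using that(2) R_comm[OF that] by (simp_all add: commutes_def)
    ultimately show "z \<in> N" by (simp add: N_def)
  qed
  have cl: "closed N"
    unfolding N_def
    by (intro closed_Collect_eq linear_continuous_on G.bounded_linear_axioms R.bounded_linear_axioms)
  have inv_N: "G ` N \<subseteq> N" "R ` N \<subseteq> N"
    by (intro hyper G.bounded_linear_axioms R.bounded_linear_axioms; simp add: commutes_def GR)+
  then have inv: "G ` orth N \<subseteq> orth N" "R ` orth N \<subseteq> orth N"
    using self_adjoint_orth_invariant[OF G inv_N(1)]
      self_adjoint_orth_invariant[OF pos_semidefD(1)[OF R(1)] inv_N(2)] by blast+
  have neg: "G x \<bullet> x < 0" if x: "x \<in> orth N" "x \<noteq> 0" for x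
  proof -
    have "R x + G x \<in> N"
      by (simp add: N_def G.add R.add GR R(2))
    moreover have "R x + G x \<in> orth N"
      using inv x(1) by (auto intro!: subspace_add[OF subspace_orth])
    ultimately have "(R x + G x) \<bullet> (R x + G x) = 0"
      by (simp add: orth_def)
    then have Gx: "G x = - R x"
      by (simp add: add_eq_0_iff)
    have "G x \<bullet> x \<noteq> 0"
    proof
      assume "G x \<bullet> x = 0"
      then have "R x = 0"
        using pos_semidef_form_eq_0D[OF R(1)] Gx by simp
      then have "x \<in> N" using Gx by (simp add: N_def)
      with x show False by (auto simp: orth_def)
    qed
    with Gx pos_semidefD(2)[OF R(1), of x] show ?thesis by simp
  qed
  show thesis
  proof (rule that)
    show "hyperinvariant G N"
      using sub cl hyper by (simp add: hyperinvariant_def)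
    show "0 \<le> G x \<bullet> x" if "x \<in> N" for x
      using that pos_semidefD(2)[OF R(1), of x] by (simp add: N_def)
  qed (rule neg)
qed

text \<open>
  If the spectrum of \<open>P\<^sup>2\<close> accumulated at \<open>\<mu>\<close> from below, \<open>P\<close> would not attain its norm on the spectral
  subspace for \<open>(-\<infinity>, \<mu>)\<close>. Hence, with \<open>G = P\<^sup>2 - \<mu>\<close>, some interval \<open>(-\<epsilon>, 0)\<close> is free of spectrum of
  \<open>G\<close>, and this is expressed without spectra by \<open>G\<^sup>2 + \<epsilon> G \<ge> 0\<close>.
\<close>

lemma spectral_gap_below:
  fixes P :: "'a::{real_inner,banach} \<Rightarrow> 'a"
  assumes P: "self_adjoint P"
    and attain: "\<And>N. hyperinvariant P N \<Longrightarrow> orth N \<noteq> {0} \<Longrightarrow> attains_norm P (orth N)"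
  obtains \<epsilon> where "\<epsilon> > 0"
    "\<And>x. 0 \<le> (norm (P (P x) - \<mu> *\<^sub>R x))\<^sup>2 + \<epsilon> * ((P (P x) - \<mu> *\<^sub>R x) \<bullet> x)"
proof -
  interpret P: bounded_linear P using P by (rule self_adjointD)
  define G where "G x = P (P x) - \<mu> *\<^sub>R x" for x
  have "bounded_linear G"
    unfolding G_def
    by (intro bounded_linear_sub bounded_linear_compose[OF P.bounded_linear_axioms P.bounded_linear_axioms] bounded_linear_intros)
  then interpret G: bounded_linear G .
  have G: "self_adjoint G"
    using P G.bounded_linear_axioms by (simp add: self_adjoint_def G_def inner_diff)
  have G_form: "G x \<bullet> x = (norm (P x))\<^sup>2 - \<mu> * (norm x)\<^sup>2" for x
    using self_adjointD(2)[OF P, of "P x" x]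
    by (simp add: G_def inner_diff power2_norm_eq_inner)
  obtain N where N: "hyperinvariant G N" "\<And>x. x \<in> N \<Longrightarrow> 0 \<le> G x \<bullet> x"
      "\<And>x. x \<in> orth N \<Longrightarrow> x \<noteq> 0 \<Longrightarrow> G x \<bullet> x < 0"
    using sign_splitting[OF G] by blast
  have N_sub: "subspace N" "closed N"
    using N(1) by (auto simp: hyperinvariant_def)
  have "commutes Y G" if "bounded_linear Y" "commutes Y P" for Y
  proof -
    interpret Y: bounded_linear Y by fact
    show ?thesis using that(2) by (simp add: commutes_def G_def Y.diff Y.scaleR)
  qed
  then have hyper: "hyperinvariant P N"
    using N(1) by (simp add: hyperinvariant_def)
  have GN: "G ` N \<subseteq> N"
    using N(1) G.bounded_linear_axioms by (simp add: hyperinvariant_def commutes_def)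
  have GN': "G ` orth N \<subseteq> orth N"
    using G GN by (rule self_adjoint_orth_invariant)
  obtain \<epsilon> where \<epsilon>: "\<epsilon> > 0" "\<And>x. x \<in> orth N \<Longrightarrow> \<epsilon> * (norm x)\<^sup>2 \<le> - (G x \<bullet> x)"
  proof (cases "orth N = {0}")
    case True
    then show ?thesis using that[of 1] by simp
  next
    case False
    with hyper attain obtain z where z: "z \<in> orth N" "norm z = 1"
        "\<And>y. y \<in> orth N \<Longrightarrow> norm (P y) \<le> norm (P z) * norm y"
      unfolding attains_norm_def by meson
    have "z \<noteq> 0" using z(2) by auto
    \<comment> \<open>The gap is the distance from \<open>\<mu>\<close> to the attained square of the norm on the negative part.\<close>
    show ?thesis
    proof (rule that)
      show "0 < - (G z \<bullet> z)" using N(3)[OF z(1) \<open>z \<noteq> 0\<close>] by simp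
      fix x assume "x \<in> orth N"
      then have "(norm (P x))\<^sup>2 \<le> (norm (P z) * norm x)\<^sup>2"
        using z(3) by (intro power_mono) auto
      then show "- (G z \<bullet> z) * (norm x)\<^sup>2 \<le> - (G x \<bullet> x)"
        using z(2) by (simp add: G_form power_mult_distrib algebra_simps)
    qed
  qed
  have lower: "0 \<le> (norm (G n))\<^sup>2 + \<epsilon> * (G n \<bullet> n)" if "n \<in> orth N" for n
  proof -
    have CS: "- (G n \<bullet> n) \<le> norm (G n) * norm n"
      using norm_cauchy_schwarz[of "- G n" n] by simp
    with \<epsilon>(2)[OF that] have "(\<epsilon> * norm n) * norm n \<le> norm (G n) * norm n"
      by (simp add: power2_eq_square mult_ac)
    then have "\<epsilon> * norm n \<le> norm (G n)"
      using \<epsilon>(1) by (cases "n = 0") (auto simp: mult_le_cancel_right)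
    then have "norm (G n) * (\<epsilon> * norm n) \<le> norm (G n) * norm (G n)"
      by (rule mult_left_mono) simp
    moreover have "\<epsilon> * (- (G n \<bullet> n)) \<le> \<epsilon> * (norm (G n) * norm n)"
      using CS \<epsilon>(1) by (intro mult_left_mono) auto
    ultimately show ?thesis
      by (simp add: power2_eq_square mult_ac)
  qed
  have "0 \<le> (norm (G x))\<^sup>2 + \<epsilon> * (G x \<bullet> x)" for x
  proof -
    obtain m n where mn: "m \<in> N" "n \<in> orth N" "x = m + n"
      using orth_decomposition[OF N_sub] by blast
    have "G m \<in> N" "G n \<in> orth N" using mn GN GN' by auto
    with mn have orth0: "G n \<bullet> G m = 0" "G n \<bullet> m = 0" "G m \<bullet> n = 0" "G m \<bullet> G n = 0"
      by (auto simp: orth_def inner_commute[of "G m"])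
    have "(norm (G x))\<^sup>2 = (norm (G m))\<^sup>2 + (norm (G n))\<^sup>2"
      by (simp add: mn(3) G.add power2_norm_eq_inner inner_add orth0)
    moreover have "\<epsilon> * (G x \<bullet> x) = \<epsilon> * (G m \<bullet> m) + \<epsilon> * (G n \<bullet> n)"
      by (simp add: mn(3) G.add inner_add orth0 algebra_simps)
    moreover have "0 \<le> \<epsilon> * (G m \<bullet> m)"
      using N(2)[OF mn(1)] \<epsilon>(1) by simp
    moreover have "0 \<le> (norm (G m))\<^sup>2" by simp
    ultimately show ?thesis
      using lower[OF mn(2)] by linarith
  qed
  with \<epsilon>(1) show thesis
    using that unfolding G_def by blast
qed

section \<open>Boundedness below and finite codimension\<close>

lemma subspace_closure:
  fixes W :: "'a::real_normed_vector set"
  assumes W: "subspace W"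
  shows "subspace (closure W)"
proof (rule subspaceI)
  show "0 \<in> closure W"
    using subspace_0[OF W] closure_subset by blast
  fix x y assume "x \<in> closure W" "y \<in> closure W"
  then obtain f g where "\<And>n. f n \<in> W" "f \<longlonglongrightarrow> x" "\<And>n. g n \<in> W" "g \<longlonglongrightarrow> y"
    unfolding closure_sequential by metis
  then have "\<And>n. f n + g n \<in> W" "(\<lambda>n. f n + g n) \<longlonglongrightarrow> x + y"
    by (auto intro: subspace_add[OF W] tendsto_add)
  then show "x + y \<in> closure W"
    using closure_sequential[of "x + y" W] by (metis (no_types, lifting))
next
  fix x and c :: real assume "x \<in> closure W"
  then obtain f where "\<And>n. f n \<in> W" "f \<longlonglongrightarrow> x"
    unfolding closure_sequential by metis
  then have "\<And>n. c *\<^sub>R f n \<in> W" "(\<lambda>n. c *\<^sub>R f n) \<longlonglongrightarrow> c *\<^sub>R x"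
    by (auto intro: subspace_scale[OF W] tendsto_scaleR)
  then show "c *\<^sub>R x \<in> closure W"
    using closure_sequential[of "c *\<^sub>R x" W] by (metis (no_types, lifting))
qed

lemma bounded_below_closure:
  assumes R: "bounded_linear R" and W: "\<And>x. x \<in> W \<Longrightarrow> c * norm x \<le> norm (R x)"
    and x: "x \<in> closure W"
  shows "c * norm x \<le> norm (R x)"
proof -
  have "closed {x. c * norm x \<le> norm (R x)}"
    by (intro closed_Collect_le continuous_intros linear_continuous_on R)
  moreover have "W \<subseteq> {x. c * norm x \<le> norm (R x)}"
    using W by auto
  ultimately show ?thesis
    using x closure_minimal by blast
qed

text \<open>
  The image of the closure \<open>V\<close> of \<open>W\<close> is closed because \<open>R\<close> is bounded below on \<open>V\<close>. By injectivity a
  vector \<open>v\<close> outside \<open>V\<close> is mapped outside this image, hence to a positive distance \<open>d\<close> from it, and \<open>d\<close>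
  controls the coefficient of \<open>v\<close>.
\<close>

lemma bounded_below_add_vector:
  fixes R :: "'a::banach \<Rightarrow> 'a"
  assumes R: "bounded_linear R" and W: "subspace W" and c: "c > 0"
    and below: "\<And>w. w \<in> W \<Longrightarrow> c * norm w \<le> norm (R w)"
    and M: "subspace M" "closed M" "W \<subseteq> M" "v \<in> M" and inj: "\<And>x. x \<in> M \<Longrightarrow> R x = 0 \<Longrightarrow> x = 0"
  obtains c' where "c' > 0" "\<And>w t. w \<in> W \<Longrightarrow> c' * norm (w + t *\<^sub>R v) \<le> norm (R (w + t *\<^sub>R v))"
proof -
  interpret R: bounded_linear R by fact
  define V where "V = closure W"
  have V: "subspace V" "W \<subseteq> V" "V \<subseteq> M" "closed V"
    using subspace_closure[OF W] closure_subset closure_minimal[OF M(3,2)] by (auto simp: V_def)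
  have below': "c * norm w \<le> norm (R w)" if "w \<in> V" for w
    using bounded_below_closure[OF R below] that by (simp add: V_def)
  show thesis
  proof (cases "v \<in> V")
    case True
    have "c * norm (w + t *\<^sub>R v) \<le> norm (R (w + t *\<^sub>R v))" if "w \<in> W" for w t
      using that V(2) True by (intro below' subspace_add subspace_scale V(1)) auto
    with c show thesis by (rule that)
  next
    case False
    have "complete (R ` V)"
      using below' V c R
      by (intro complete_isometric_image[of c]) (auto simp: complete_eq_closed)
    then have "closed (R ` V)" by (simp add: complete_eq_closed)
    moreover have "R v \<notin> R ` V"
    proof
      assume "R v \<in> R ` V"
      then obtain w where "w \<in> V" "R v = R w" by auto
      have "v - w \<in> M"
        using \<open>w \<in> V\<close> V(3) M(4) by (blast intro: subspace_diff[OF M(1)])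
      with \<open>R v = R w\<close> have "v - w = 0"
        using inj[of "v - w"] by (simp add: R.diff)
      with \<open>w \<in> V\<close> False show False by simp
    qed
    ultimately have "open (- (R ` V))" "R v \<in> - (R ` V)" by auto
    then obtain d where d: "d > 0" "ball (R v) d \<subseteq> - (R ` V)"
      by (meson open_contains_ball)
    have dist: "\<bar>t\<bar> * d \<le> norm (R (w + t *\<^sub>R v))" if "w \<in> V" for w t
    proof (cases "t = 0")
      case False
      have "R ((- 1 / t) *\<^sub>R w) \<in> R ` V"
        using that V(1) by (intro imageI subspace_scale)
      then have "R ((- 1 / t) *\<^sub>R w) \<notin> ball (R v) d" using d(2) by blast
      then have "d \<le> norm (R v + (1 / t) *\<^sub>R R w)"
        by (simp add: dist_norm R.scaleR R.neg)
      then have "\<bar>t\<bar> * d \<le> norm (t *\<^sub>R (R v + (1 / t) *\<^sub>R R w))"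
        by (simp add: mult_left_mono)
      also have "t *\<^sub>R (R v + (1 / t) *\<^sub>R R w) = R (w + t *\<^sub>R v)"
        using False by (simp add: R.add R.scaleR scaleR_add_right add.commute)
      finally show ?thesis .
    qed simp
    \<comment> \<open>Since \<open>\<bar>t\<bar> \<le> r / d\<close> and \<open>c \<parallel>w\<parallel> \<le> r + \<bar>t\<bar> \<parallel>R v\<parallel>\<close> for \<open>r = \<parallel>R (w + t v)\<parallel>\<close>, this \<open>a\<close> bounds \<open>\<parallel>w + t v\<parallel> / r\<close>.\<close>
    define a where "a = 1 / c + norm (R v) / (c * d) + norm v / d"
    have "a > 0"
      unfolding a_def using c d(1) by (intro add_pos_nonneg) auto
    have est: "norm (w + t *\<^sub>R v) \<le> a * norm (R (w + t *\<^sub>R v))" if "w \<in> W" for w t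
    proof -
      let ?r = "norm (R (w + t *\<^sub>R v))"
      have t: "\<bar>t\<bar> \<le> ?r / d"
        using dist[of w t] that V(2) d(1) by (auto simp: field_simps)
      have "c * norm w \<le> norm (R (w + t *\<^sub>R v) - t *\<^sub>R R v)"
        using below[OF that] by (simp add: R.add R.scaleR)
      also have "\<dots> \<le> ?r + \<bar>t\<bar> * norm (R v)"
        by (rule order.trans[OF norm_triangle_ineq4]) simp
      also have "\<dots> \<le> ?r + ?r / d * norm (R v)"
        by (intro add_left_mono mult_right_mono t) simp
      finally have "norm w \<le> ?r / c + ?r * norm (R v) / (c * d)"
        using c d(1) by (simp add: field_simps)
      moreover have "norm (w + t *\<^sub>R v) \<le> norm w + \<bar>t\<bar> * norm v"
        by (rule order.trans[OF norm_triangle_ineq]) simp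
      moreover have "\<bar>t\<bar> * norm v \<le> ?r / d * norm v"
        by (intro mult_right_mono t) simp
      ultimately show ?thesis by (simp add: a_def algebra_simps)
    qed
    show thesis
    proof (rule that)
      show "0 < 1 / a" using \<open>a > 0\<close> by simp
      show "1 / a * norm (w + t *\<^sub>R v) \<le> norm (R (w + t *\<^sub>R v))" if "w \<in> W" for w t
        using est[OF that, of t] \<open>a > 0\<close> by (simp add: field_simps)
    qed
  qed
qed

text \<open>
  Dropping one linear condition enlarges the image of the remaining vectors by at most one dimension,
  which \<open>bounded_below_add_vector\<close> allows. The bound is on \<open>R\<close> over its own range because that is the
  form in which the gap condition arrives.
\<close>

lemma bounded_below_finite_codimension:
  fixes R :: "'a::{real_inner,banach} \<Rightarrow> 'a"
  assumes R: "bounded_linear R" and M: "subspace M" "closed M" "R ` M \<subseteq> M"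
    and inj: "\<And>x. x \<in> M \<Longrightarrow> R x = 0 \<Longrightarrow> x = 0"
    and "finite F" "c > 0"
    and "\<And>x. x \<in> M \<Longrightarrow> (\<And>b. b \<in> F \<Longrightarrow> x \<bullet> b = 0) \<Longrightarrow> c * norm (R x) \<le> norm (R (R x))"
  obtains c' where "c' > 0" "\<And>x. x \<in> M \<Longrightarrow> c' * norm (R x) \<le> norm (R (R x))"
proof -
  interpret R: bounded_linear R by fact
  from assms(6-8) have "\<exists>c'>0. \<forall>x\<in>M. c' * norm (R x) \<le> norm (R (R x))"
  proof (induction F arbitrary: c)
    case empty
    then show ?case by auto
  next
    case (insert b F)
    define K where "K = {x \<in> M. \<forall>b\<in>insert b F. x \<bullet> b = 0}"
    have K: "subspace K"
      using M(1) by (auto simp: K_def subspace_def inner_add)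
    have below: "c * norm w \<le> norm (R w)" if "w \<in> R ` K" for w
      using that insert.prems(2) by (auto simp: K_def)
    show ?case
    proof (cases "\<exists>v\<in>M. (\<forall>b\<in>F. v \<bullet> b = 0) \<and> v \<bullet> b \<noteq> 0")
      case False
      then show ?thesis
        using insert.prems by (intro insert.IH[of c]) auto
    next
      case True
      then obtain v where v: "v \<in> M" "\<forall>b\<in>F. v \<bullet> b = 0" "v \<bullet> b \<noteq> 0" by blast
      have "subspace (R ` K)"
        using K by (rule linear_subspace_image[OF R.linear_axioms])
      moreover have "R ` K \<subseteq> M" "R v \<in> M"
        using M(3) v(1) by (auto simp: K_def)
      ultimately obtain c' where c': "c' > 0"
          "\<And>w t. w \<in> R ` K \<Longrightarrow> c' * norm (w + t *\<^sub>R R v) \<le> norm (R (w + t *\<^sub>R R v))"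
        using bounded_below_add_vector[OF R _ insert.prems(1) below M(1,2) _ _ inj] by blast
      show ?thesis
      proof (rule insert.IH[OF c'(1)])
        fix x assume x: "x \<in> M" "\<And>b. b \<in> F \<Longrightarrow> x \<bullet> b = 0"
        define t where "t = (x \<bullet> b) / (v \<bullet> b)"
        have "x - t *\<^sub>R v \<in> K"
          using x v M(1) by (auto simp: K_def t_def inner_diff intro!: subspace_diff subspace_scale)
        then have "c' * norm (R (x - t *\<^sub>R v) + t *\<^sub>R R v) \<le> norm (R (R (x - t *\<^sub>R v) + t *\<^sub>R R v))"
          by (intro c'(2) imageI)
        then show "c' * norm (R x) \<le> norm (R (R x))"
          by (simp add: R.diff R.scaleR)
      qed
    qed
  qed
  then show thesis using that by blast
qed

text \<open>
  An injective self-adjoint operator has dense range, so the bound extends from the range to \<open>M\<close>.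
\<close>

lemma bounded_below_on_range_imp:
  fixes R :: "'a::{real_inner,banach} \<Rightarrow> 'a"
  assumes R: "self_adjoint R" and M: "subspace M" "closed M" "R ` M \<subseteq> M"
    and inj: "\<And>x. x \<in> M \<Longrightarrow> R x = 0 \<Longrightarrow> x = 0"
    and below: "\<And>x. x \<in> M \<Longrightarrow> c * norm (R x) \<le> norm (R (R x))"
    and x: "x \<in> M"
  shows "c * norm x \<le> norm (R x)"
proof -
  interpret R: bounded_linear R using R by (rule self_adjointD)
  define V where "V = closure (R ` M)"
  have V: "subspace V" "closed V" "R ` M \<subseteq> V" "V \<subseteq> M"
    using subspace_closure[OF linear_subspace_image[OF R.linear_axioms M(1)]]
      closure_subset[of "R ` M"] closure_minimal[OF M(3,2)] by (simp_all add: V_def)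
  obtain p q where pq: "p \<in> V" "q \<in> orth V" "x = p + q"
    using orth_decomposition[OF V(1,2)] by blast
  then have q: "q \<in> M"
    using x V(4) M(1) by (metis add_diff_cancel_left' subset_iff subspace_diff)
  then have "R q \<bullet> R q = q \<bullet> R (R q)"
    using self_adjointD(2)[OF R] by blast
  also have "\<dots> = 0"
  proof -
    have "R (R q) \<in> V" using V(3) M(3) q by blast
    with pq(2) show ?thesis by (simp add: orth_def)
  qed
  finally have "q = 0" using inj[OF q] by simp
  with pq have "x \<in> closure (R ` M)" by (simp add: V_def)
  then show ?thesis
    using bounded_below_closure[OF R.bounded_linear_axioms] below by blast
qed

section \<open>Norm attainment under finite-codimensional changes\<close>

lemma projection_exists:
  fixes M :: "'a::{real_inner,banach} set"
  assumes M: "subspace M" "closed M"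
  obtains p where "self_adjoint p" "\<And>x. p x \<in> M" "\<And>x. x \<in> M \<Longrightarrow> p x = x"
    "\<And>Y. bounded_linear Y \<Longrightarrow> Y ` M \<subseteq> M \<Longrightarrow> Y ` orth M \<subseteq> orth M \<Longrightarrow> commutes Y p"
proof -
  have "\<exists>m. m \<in> M \<and> x - m \<in> orth M" for x
    using orth_decomposition[OF M, of x] by (metis add_diff_cancel_left')
  then obtain p where p: "\<And>x. p x \<in> M" "\<And>x. x - p x \<in> orth M"
    by metis
  have unique: "p x = m" if "m \<in> M" "x - m \<in> orth M" for x m
  proof -
    have "p x - m \<in> M"
      using p(1) that(1) M(1) by (blast intro: subspace_diff)
    moreover have "(x - m) - (x - p x) \<in> orth M"
      by (rule subspace_diff[OF subspace_orth that(2) p(2)])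
    ultimately have "(p x - m) \<bullet> (p x - m) = 0"
      by (simp add: orth_def)
    then show ?thesis by simp
  qed
  have perp: "x \<bullet> m = p x \<bullet> m" if "m \<in> M" for x m
    using p(2)[of x] that by (simp add: orth_def inner_diff)
  show thesis
  proof (rule that)
    have "bounded_linear p"
    proof (rule bounded_linear_intro)
      show "p (x + y) = p x + p y" for x y
      proof (rule unique)
        have "(x - p x) + (y - p y) \<in> orth M"
          by (rule subspace_add[OF subspace_orth p(2) p(2)])
        then show "x + y - (p x + p y) \<in> orth M" by (simp add: algebra_simps)
      qed (use p(1) M(1) in \<open>blast intro: subspace_add\<close>)
      show "p (r *\<^sub>R x) = r *\<^sub>R p x" for r x
      proof (rule unique)
        have "r *\<^sub>R (x - p x) \<in> orth M"
          by (rule subspace_scale[OF subspace_orth p(2)])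
        then show "r *\<^sub>R x - r *\<^sub>R p x \<in> orth M" by (simp add: algebra_simps)
      qed (use p(1) M(1) in \<open>blast intro: subspace_scale\<close>)
      show "norm (p x) \<le> norm x * 1" for x
      proof -
        have "norm (p x) * norm (p x) = x \<bullet> p x"
          using perp[OF p(1), of x x] by (simp flip: power2_norm_eq_inner power2_eq_square)
        also have "\<dots> \<le> norm x * norm (p x)" by (rule norm_cauchy_schwarz)
        finally show ?thesis
          by (cases "norm (p x) = 0") (simp_all add: mult_le_cancel_right)
      qed
    qed
    moreover have "p x \<bullet> y = x \<bullet> p y" for x y
      using perp[OF p(1), of x y] perp[OF p(1), of y x] by (simp add: inner_commute)
    ultimately show "self_adjoint p" by (simp add: self_adjoint_def)
    show "p x \<in> M" for x by (rule p)
    show "p x = x" if "x \<in> M" for x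
      using that by (intro unique) (simp_all add: subspace_0 subspace_orth)
    fix Y :: "'a \<Rightarrow> 'a"
    assume Y: "bounded_linear Y" "Y ` M \<subseteq> M" "Y ` orth M \<subseteq> orth M"
    interpret Y: bounded_linear Y by fact
    have "p (Y x) = Y (p x)" for x
    proof (rule unique)
      show "Y (p x) \<in> M" using Y(2) p(1) by blast
      show "Y x - Y (p x) \<in> orth M"
        using Y(3) p(2)[of x] by (auto simp flip: Y.diff)
    qed
    then show "commutes Y p" by (simp add: commutes_def)
  qed
qed

text \<open>
  Let \<open>s\<close> be the norm of \<open>Q\<close> on \<open>M\<close>. If it is not attained, \<open>D = s\<^sup>2 - Q\<^sup>2\<close> is strictly positive on \<open>M\<close>, so
  \<open>R = sqrt D\<close> is injective there. On the vectors of \<open>M\<close> orthogonal to \<open>F\<close>, where \<open>Q\<^sup>2\<close> agrees with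
  \<open>P\<^sup>2\<close>, the gap of \<open>P\<^sup>2\<close> below \<open>s\<^sup>2\<close> reads \<open>D\<^sup>2 \<ge> \<epsilon> D\<close>, that is \<open>\<parallel>R (R x)\<parallel>\<^sup>2 \<ge> \<epsilon> \<parallel>R x\<parallel>\<^sup>2\<close>. The two
  lemmas on boundedness below turn this into \<open>\<parallel>R x\<parallel> \<ge> c \<parallel>x\<parallel>\<close> on \<open>M\<close>, so that \<open>Q\<^sup>2 \<le> s\<^sup>2 - c\<^sup>2\<close> on \<open>M\<close>,
  contradicting the choice of \<open>s\<close>.
\<close>

lemma finite_codim_perturbation_attains_norm:
  fixes P Q :: "'a::{real_inner,banach} \<Rightarrow> 'a"
  assumes P: "self_adjoint P"
    and attain: "\<And>N. hyperinvariant P N \<Longrightarrow> orth N \<noteq> {0} \<Longrightarrow> attains_norm P (orth N)"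
    and Q: "self_adjoint Q"
    and F: "finite F" "\<And>x. (\<And>b. b \<in> F \<Longrightarrow> x \<bullet> b = 0) \<Longrightarrow> Q (Q x) = P (P x)"
    and M: "subspace M" "closed M" "M \<noteq> {0}" "Q ` M \<subseteq> M"
  shows "attains_norm Q M"
proof (rule ccontr)
  assume not_attained: "\<not> attains_norm Q M"
  interpret Q: bounded_linear Q using Q by (rule self_adjointD)
  define U where "U = {y \<in> M. norm y = 1}"
  define s where "s = (SUP y\<in>U. norm (Q y))"
  obtain k where k: "\<And>x. norm (Q x) \<le> norm x * k"
    using Q.bounded by blast
  have bdd: "bdd_above ((\<lambda>y. norm (Q y)) ` U)"
    using k by (intro bdd_aboveI2[of _ _ k]) (metis (mono_tags, lifting) U_def mem_Collect_eq mult_1)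
  obtain u where u: "u \<in> U"
  proof -
    obtain z where "z \<in> M" "z \<noteq> 0" using M(1,3) subspace_0 by blast
    then have "(1 / norm z) *\<^sub>R z \<in> U"
      using M(1) by (simp add: U_def subspace_scale)
    then show thesis by (rule that)
  qed
  have le_s: "norm (Q y) \<le> s * norm y" if "y \<in> M" for y
  proof (cases "y = 0")
    case False
    then have "(1 / norm y) *\<^sub>R y \<in> U"
      using that M(1) by (simp add: U_def subspace_scale)
    then have "norm (Q ((1 / norm y) *\<^sub>R y)) \<le> s"
      unfolding s_def by (rule cSUP_upper[OF _ bdd])
    then show ?thesis using False by (simp add: Q.scaleR field_simps)
  qed (simp add: Q.zero)
  have less_s: "norm (Q y) < s * norm y" if y: "y \<in> M" "y \<noteq> 0" for y
  proof (rule ccontr)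
    assume "\<not> ?thesis"
    with le_s[OF y(1)] have eq: "norm (Q y) = s * norm y" by simp
    define z where "z = (1 / norm y) *\<^sub>R y"
    have "z \<in> M" "norm z = 1" "norm (Q z) = s"
      using y M(1) eq by (simp_all add: z_def subspace_scale Q.scaleR)
    with le_s not_attained show False by (auto simp: attains_norm_def)
  qed
  have "0 < s"
  proof -
    have "u \<in> M" "norm u = 1" using u by (auto simp: U_def)
    then have "norm (Q u) < s * 1"
      using less_s[of u] by fastforce
    then show ?thesis using norm_ge_zero[of "Q u"] by linarith
  qed
  obtain p where p: "self_adjoint p" "\<And>x. p x \<in> M" "\<And>x. x \<in> M \<Longrightarrow> p x = x"
    by (rule projection_exists[OF M(1,2)]) metis
  interpret p: bounded_linear p using p(1) by (rule self_adjointD)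
  \<comment> \<open>Compressing to \<open>M\<close> makes \<open>D\<close> positive on the whole space, where square roots are available.\<close>
  define D where "D x = p (s\<^sup>2 *\<^sub>R p x - Q (Q (p x)))" for x
  have "bounded_linear D"
  proof -
    note pl = p.bounded_linear_axioms and Ql = Q.bounded_linear_axioms
    have "bounded_linear (\<lambda>x. s\<^sup>2 *\<^sub>R p x - Q (Q (p x)))"
      by (intro bounded_linear_sub bounded_linear_const_scaleR pl
          bounded_linear_compose[OF Ql bounded_linear_compose[OF Ql pl]])
    from bounded_linear_compose[OF pl this] show ?thesis by (simp add: D_def[abs_def])
  qed
  moreover have D_sym: "D x \<bullet> y = s\<^sup>2 * (p x \<bullet> p y) - Q (p x) \<bullet> Q (p y)" for x y
    by (simp add: D_def self_adjointD(2)[OF p(1)] inner_diff self_adjointD(2)[OF Q])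
  moreover have "0 \<le> D x \<bullet> x" for x
  proof -
    have "(norm (Q (p x)))\<^sup>2 \<le> (s * norm (p x))\<^sup>2"
      using le_s[OF p(2)] by (intro power_mono) auto
    then show ?thesis
      by (simp add: D_sym power_mult_distrib flip: power2_norm_eq_inner)
  qed
  ultimately have D: "pos_semidef D"
    by (simp add: pos_semidef_def self_adjoint_def D_sym inner_commute[of _ "D _"])
       (simp add: inner_commute)
  have D_M: "D x = s\<^sup>2 *\<^sub>R x - Q (Q x)" if "x \<in> M" for x
  proof -
    have "s\<^sup>2 *\<^sub>R x - Q (Q x) \<in> M"
      using that M(4) by (intro subspace_diff subspace_scale M(1)) auto
    then show ?thesis using that by (simp add: D_def p(3))
  qed
  obtain R where R: "pos_semidef R" "\<And>x. R (R x) = D x"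
      "\<And>Y. bounded_linear Y \<Longrightarrow> commutes Y D \<Longrightarrow> commutes Y R"
    by (rule sqrt_exists[OF D]) metis
  have R_sa: "self_adjoint R" using R(1) by (rule pos_semidefD)
  have "commutes p D"
    by (simp add: commutes_def D_def p(2,3))
  then have "commutes p R" by (rule R(3)[OF p.bounded_linear_axioms])
  then have RM: "R ` M \<subseteq> M"
    using p(2,3) by (metis commutes_def image_subsetI)
  have R_norm: "(norm (R x))\<^sup>2 = s\<^sup>2 * (norm x)\<^sup>2 - (norm (Q x))\<^sup>2" if "x \<in> M" for x
    using self_adjointD(2)[OF R_sa, of x "R x"] self_adjointD(2)[OF Q, of x "Q x"] that
    by (simp add: power2_norm_eq_inner R(2) D_M inner_diff)
  have inj: "x = 0" if "x \<in> M" "R x = 0" for x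
  proof (rule ccontr)
    assume "x \<noteq> 0"
    then have "(norm (Q x))\<^sup>2 < (s * norm x)\<^sup>2"
      using less_s[OF that(1)] by (intro power_strict_mono) auto
    with R_norm[OF that(1)] that(2) show False by (simp add: power_mult_distrib)
  qed
  obtain \<epsilon> where \<epsilon>: "\<epsilon> > 0"
      "\<And>x. 0 \<le> (norm (P (P x) - s\<^sup>2 *\<^sub>R x))\<^sup>2 + \<epsilon> * ((P (P x) - s\<^sup>2 *\<^sub>R x) \<bullet> x)"
  proof -
    from P have "\<exists>\<epsilon>>0. \<forall>x. 0 \<le> (norm (P (P x) - s\<^sup>2 *\<^sub>R x))\<^sup>2 + \<epsilon> * ((P (P x) - s\<^sup>2 *\<^sub>R x) \<bullet> x)"
      by (rule spectral_gap_below) (use attain in auto)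
    then show thesis using that by blast
  qed
  have below: "sqrt \<epsilon> * norm (R x) \<le> norm (R (R x))"
    if x: "x \<in> M" "\<And>b. b \<in> F \<Longrightarrow> x \<bullet> b = 0" for x
  proof -
    have "P (P x) - s\<^sup>2 *\<^sub>R x = - R (R x)"
      by (simp add: R(2) D_M x(1) F(2)[OF x(2)])
    with \<epsilon>(2)[of x] have "\<epsilon> * (R (R x) \<bullet> x) \<le> (norm (R (R x)))\<^sup>2" by simp
    then have "(sqrt \<epsilon> * norm (R x))\<^sup>2 \<le> (norm (R (R x)))\<^sup>2"
      using \<epsilon>(1) self_adjointD(2)[OF R_sa, of "R x" x]
      by (simp add: power_mult_distrib power2_norm_eq_inner)
    then show ?thesis by (rule power2_le_imp_le) simp
  qed
  have "\<exists>c>0. \<forall>x\<in>M. c * norm (R x) \<le> norm (R (R x))"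
  proof (rule bounded_below_finite_codimension[OF self_adjointD(1)[OF R_sa] M(1,2) RM])
    show "sqrt \<epsilon> > 0" using \<epsilon>(1) by simp
  qed (use inj F(1) below in auto)
  then obtain c where c: "c > 0" "\<And>x. x \<in> M \<Longrightarrow> c * norm (R x) \<le> norm (R (R x))"
    by blast
  have c_le: "c * norm x \<le> norm (R x)" if "x \<in> M" for x
    using R_sa M(1,2) RM inj c(2) that by (rule bounded_below_on_range_imp)
  have Q_le: "norm (Q y) \<le> sqrt (s\<^sup>2 - c\<^sup>2)" if "y \<in> U" for y
  proof (rule real_le_rsqrt)
    have y: "y \<in> M" "norm y = 1" using that by (auto simp: U_def)
    then have "c\<^sup>2 \<le> (norm (R y))\<^sup>2"
      using c_le[OF y(1)] c(1) by (intro power_mono) auto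
    then show "(norm (Q y))\<^sup>2 \<le> s\<^sup>2 - c\<^sup>2"
      using R_norm[OF y(1)] y(2) by simp
  qed
  have "s \<le> sqrt (s\<^sup>2 - c\<^sup>2)"
    by (subst (1) s_def, rule cSUP_least) (use u Q_le in auto)
  also have "\<dots> < sqrt (s\<^sup>2)"
    using c(1) by (intro real_sqrt_less_mono) simp
  finally show False using \<open>0 < s\<close> by simp
qed

section \<open>Complex Hilbert space operators\<close>

instance complex_hilbert_space \<subseteq> banach ..

lemma cinner_eq_Complex:
  fixes x y :: "'a::complex_inner"
  shows "cinner x y = Complex (x \<bullet> y) (x \<bullet> (\<i> *\<^sub>C y))"
proof -
  have "cinner x (\<i> *\<^sub>C y) = cnj (cinner (\<i> *\<^sub>C y) x)"
    by (rule cinner_commute)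
  also have "\<dots> = - \<i> * cinner x y"
    by (simp add: cinner_scaleC_left cinner_commute[of x y])
  finally show ?thesis
    by (simp add: complex_eq_iff inner_eq_Re_cinner)
qed

lemma inner_scaleC_left:
  fixes x y :: "'a::complex_inner"
  shows "(a *\<^sub>C x) \<bullet> y = x \<bullet> (cnj a *\<^sub>C y)"
proof -
  have "cinner x (cnj a *\<^sub>C y) = cnj (cinner (cnj a *\<^sub>C y) x)"
    by (rule cinner_commute)
  also have "\<dots> = a * cinner x y"
    by (simp add: cinner_scaleC_left cinner_commute[of x y])
  finally show ?thesis
    by (simp add: inner_eq_Re_cinner cinner_scaleC_left)
qed

lemma scaleC_ii_ii: "\<i> *\<^sub>C \<i> *\<^sub>C x = - x" for x :: "'a::complex_inner"
  using scaleC_of_real[of "-1" x] by (simp add: scaleC_scaleC)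

lemma scaleC_decomp: "a *\<^sub>C x = Re a *\<^sub>R x + Im a *\<^sub>R (\<i> *\<^sub>C x)" for x :: "'a::complex_inner"
  by (metis complex_eq mult.commute scaleC_add_left scaleC_of_real scaleC_scaleC)

lemma scaleC_real_linear:
  fixes x y :: "'a::complex_inner"
  shows "a *\<^sub>C (x + y) = a *\<^sub>C x + a *\<^sub>C y" "a *\<^sub>C (r *\<^sub>R x) = r *\<^sub>R (a *\<^sub>C x)"
  by (simp_all add: scaleC_add_right scaleC_scaleC mult.commute flip: scaleC_of_real)

lemma bounded_linear_scaleC_right: "bounded_linear (\<lambda>x::'a::complex_inner. a *\<^sub>C x)"
proof (rule bounded_linear_intro)
  show "norm (a *\<^sub>C x) \<le> norm x * cmod a" for x :: 'a
  proof -
    have "(norm (a *\<^sub>C x))\<^sup>2 = x \<bullet> (cnj a *\<^sub>C a *\<^sub>C x)"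
      by (simp add: power2_norm_eq_inner inner_scaleC_left)
    also have "\<dots> = (norm x * cmod a)\<^sup>2"
    proof -
      have "cnj a *\<^sub>C a *\<^sub>C x = (cmod a)\<^sup>2 *\<^sub>R x"
        by (simp add: scaleC_scaleC mult.commute[of "cnj a"] complex_norm_square[symmetric] flip: scaleC_of_real)
      then show ?thesis by (simp add: power_mult_distrib flip: power2_norm_eq_inner)
    qed
    finally show ?thesis by (simp add: power2_eq_iff_nonneg)
  qed
qed (simp_all add: scaleC_real_linear)

lemma bounded_operators_iff:
  "T \<in> bounded_operators \<longleftrightarrow> bounded_linear T \<and> (\<forall>a x. T (a *\<^sub>C x) = a *\<^sub>C T x)"
proof
  assume "T \<in> bounded_operators"
  then obtain C where T: "\<And>x y. T (x + y) = T x + T y" "\<And>a x. T (a *\<^sub>C x) = a *\<^sub>C T x"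
      "\<And>x. norm (T x) \<le> C * norm x"
    by (auto simp: bounded_operators_def Vector_Spaces.linear_iff)
  have "T (r *\<^sub>R x) = r *\<^sub>R T x" for r x
    using T(2)[of "complex_of_real r" x] by (simp add: scaleC_of_real)
  then have "bounded_linear T"
    using T by (intro bounded_linear_intro[of _ C]) (auto simp: mult.commute)
  with T(2) show "bounded_linear T \<and> (\<forall>a x. T (a *\<^sub>C x) = a *\<^sub>C T x)" by blast
next
  assume T: "bounded_linear T \<and> (\<forall>a x. T (a *\<^sub>C x) = a *\<^sub>C T x)"
  then interpret bounded_linear T by blast
  show "T \<in> bounded_operators"
    using T bounded by (auto simp: bounded_operators_def Vector_Spaces.linear_iff add mult.commute
        complex_vector.vector_space_axioms)
qed

lemma bounded_operatorsD:
  assumes "T \<in> bounded_operators"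
  shows "bounded_linear T" "T (a *\<^sub>C x) = a *\<^sub>C T x" "commutes ((*\<^sub>C) a) T"
  using assms by (auto simp: bounded_operators_iff commutes_def)

text \<open>
  The adjoint for the real inner product of a complex linear operator is itself complex linear, and
  therefore it is the complex adjoint.
\<close>

lemma cadjoint_props:
  fixes T :: "'a::complex_hilbert_space \<Rightarrow> 'a"
  assumes T: "T \<in> bounded_operators"
  shows "cadjoint T \<in> bounded_operators" "T x \<bullet> y = x \<bullet> cadjoint T y"
proof -
  obtain g where g: "bounded_linear g" "\<And>x y. T x \<bullet> y = x \<bullet> g y"
    by (rule real_adjoint_exists[OF bounded_operatorsD(1)[OF T]]) metis
  have g_scale: "g (a *\<^sub>C y) = a *\<^sub>C g y" for a y
  proof -
    have "x \<bullet> g (a *\<^sub>C y) = x \<bullet> (a *\<^sub>C g y)" for x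
      using inner_scaleC_left[of "cnj a" "T x" y] inner_scaleC_left[of "cnj a" x "g y"]
      by (simp flip: g(2) add: bounded_operatorsD(2)[OF T])
    then show ?thesis using vector_eq_ldot by blast
  qed
  have "cadjoint T = g"
    unfolding cadjoint_def
  proof (rule the_equality)
    show "\<forall>x y. cinner (T x) y = cinner x (g y)"
      by (simp add: cinner_eq_Complex g(2) g_scale)
    fix S assume S: "\<forall>x y. cinner (T x) y = cinner x (S y)"
    show "S = g"
    proof
      fix y
      have "x \<bullet> S y = x \<bullet> g y" for x
      proof -
        have "Re (cinner (T x) y) = Re (cinner x (S y))" using S by simp
        then show ?thesis by (simp add: g(2) flip: inner_eq_Re_cinner)
      qed
      then show "S y = g y" using vector_eq_ldot by blast
    qed
  qed
  with g g_scale show "cadjoint T \<in> bounded_operators" "T x \<bullet> y = x \<bullet> cadjoint T y"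
    by (simp_all add: bounded_operators_iff)
qed

text \<open>
  Symmetry comes from polarisation: \<open>cinner (P z) z\<close> is real at \<open>z = x + \<i> y\<close>, at \<open>x\<close> and at \<open>\<i> y\<close>.
\<close>

lemma positive_op_iff:
  "positive_op P \<longleftrightarrow> P \<in> bounded_operators \<and> pos_semidef P"
proof
  assume P: "positive_op P"
  then have P_op: "P \<in> bounded_operators" by (simp add: positive_op_def)
  interpret bounded_linear P by (rule bounded_operatorsD(1)[OF P_op])
  have re: "0 \<le> P x \<bullet> x" and im: "P x \<bullet> (\<i> *\<^sub>C x) = 0" for x
    using P by (auto simp: positive_op_def cinner_eq_Complex complex_nonneg_Reals_iff)
  have "P x \<bullet> y = x \<bullet> P y" for x y
  proof -
    let ?y = "\<i> *\<^sub>C y"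
    have "P (x + ?y) \<bullet> (\<i> *\<^sub>C (x + ?y)) = 0" by (rule im)
    then have "P x \<bullet> (\<i> *\<^sub>C ?y) + P ?y \<bullet> (\<i> *\<^sub>C x) = 0"
      using im[of x] im[of ?y] by (simp add: add scaleC_add_right scaleC_ii_ii inner_add inner_diff)
    moreover have "P ?y \<bullet> (\<i> *\<^sub>C x) = P y \<bullet> x"
      by (simp add: bounded_operatorsD(2)[OF P_op] inner_scaleC_left scaleC_scaleC)
    ultimately show ?thesis
      by (simp add: scaleC_ii_ii inner_commute)
  qed
  with re P_op show "P \<in> bounded_operators \<and> pos_semidef P"
    by (simp add: pos_semidef_def self_adjoint_def bounded_operatorsD(1))
next
  assume P: "P \<in> bounded_operators \<and> pos_semidef P"
  then have P_op: "P \<in> bounded_operators" and sa: "self_adjoint P"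
    by (auto dest: pos_semidefD)
  have "P x \<bullet> (\<i> *\<^sub>C x) = 0" for x
  proof -
    have "P x \<bullet> (\<i> *\<^sub>C x) = x \<bullet> (\<i> *\<^sub>C P x)"
      using self_adjointD(2)[OF sa, of x "\<i> *\<^sub>C x"] by (simp add: bounded_operatorsD(2)[OF P_op])
    also have "\<dots> = - (P x \<bullet> (\<i> *\<^sub>C x))"
      using inner_scaleC_left[of "- \<i>" x "P x"] scaleC_scaleC[of "-1" "\<i>" x] scaleC_of_real[of "-1"]
      by (simp add: inner_commute)
    finally show ?thesis by simp
  qed
  with P show "positive_op P"
    using pos_semidefD(2)[of P]
    by (auto simp: positive_op_def cinner_eq_Complex complex_nonneg_Reals_iff)
qed

lemma sqrt_op_props:
  fixes A :: "'a::complex_hilbert_space \<Rightarrow> 'a"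
  assumes A: "A \<in> bounded_operators" "pos_semidef A"
  shows "sqrt_op A \<in> bounded_operators" "pos_semidef (sqrt_op A)" "sqrt_op A (sqrt_op A x) = A x"
    "bounded_linear Y \<Longrightarrow> commutes Y A \<Longrightarrow> commutes Y (sqrt_op A)"
proof -
  obtain R where R: "pos_semidef R" "\<And>x. R (R x) = A x"
      "\<And>Y. bounded_linear Y \<Longrightarrow> commutes Y A \<Longrightarrow> commutes Y R"
    by (rule sqrt_exists[OF A(2)]) metis
  have "commutes ((*\<^sub>C) a) R" for a
    by (intro R(3) bounded_linear_scaleC_right bounded_operatorsD(3) A)
  then have R_op: "R \<in> bounded_operators"
    using R(1) by (simp add: bounded_operators_iff pos_semidef_def self_adjoint_def commutes_def)
  have "sqrt_op A = R"
    unfolding sqrt_op_def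
  proof (rule the_equality)
    show "positive_op R \<and> R \<circ> R = A"
      using R R_op by (auto simp: positive_op_iff)
    fix P assume P: "positive_op P \<and> P \<circ> P = A"
    then have sq: "P (P x) = A x" for x by auto
    then have "commutes P A" by (metis commutes_def)
    with P sq show "P = R"
      by (intro sqrt_unique R) (auto simp: R(2) positive_op_iff bounded_operatorsD(1))
  qed
  with R R_op show "sqrt_op A \<in> bounded_operators" "pos_semidef (sqrt_op A)"
    "sqrt_op A (sqrt_op A x) = A x"
    "bounded_linear Y \<Longrightarrow> commutes Y A \<Longrightarrow> commutes Y (sqrt_op A)"
    by blast+
qed

lemma abs_op_props:
  fixes T :: "'a::complex_hilbert_space \<Rightarrow> 'a"
  assumes T: "T \<in> bounded_operators"
  shows "abs_op T \<in> bounded_operators" "self_adjoint (abs_op T)"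
    "abs_op T (abs_op T x) = cadjoint T (T x)" "norm (abs_op T x) = norm (T x)"
    "bounded_linear Y \<Longrightarrow> commutes Y (\<lambda>x. cadjoint T (T x)) \<Longrightarrow> commutes Y (abs_op T)"
proof -
  let ?A = "\<lambda>x. cadjoint T (T x)"
  have A_op: "?A \<in> bounded_operators"
    using T cadjoint_props(1)[OF T] by (auto simp: bounded_operators_iff intro: bounded_linear_compose)
  have A_form: "?A x \<bullet> y = T x \<bullet> T y" for x y
    using cadjoint_props(2)[OF T, of y "T x"] by (simp add: inner_commute)
  then have A_pos: "pos_semidef ?A"
    using A_op by (simp add: pos_semidef_def self_adjoint_def bounded_operators_iff)
      (metis A_form inner_commute)
  have abs_eq: "abs_op T = sqrt_op ?A"
    by (simp add: abs_op_def comp_def)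
  note sq = sqrt_op_props[OF A_op A_pos, folded abs_eq]
  show "abs_op T \<in> bounded_operators" by (rule sq)
  show sa: "self_adjoint (abs_op T)" using sq(2) by (rule pos_semidefD)
  show "abs_op T (abs_op T x) = cadjoint T (T x)" by (rule sq)
  have "(norm (abs_op T x))\<^sup>2 = (norm (T x))\<^sup>2"
    using self_adjointD(2)[OF sa, of "abs_op T x" x] A_form[of x x]
    by (simp add: power2_norm_eq_inner sq(3))
  then show "norm (abs_op T x) = norm (T x)" by simp
  show "bounded_linear Y \<Longrightarrow> commutes Y ?A \<Longrightarrow> commutes Y (abs_op T)" by (rule sq)
qed

section \<open>Reducing subspaces\<close>

lemma csubspace_iff:
  fixes M :: "'a::complex_inner set"
  shows "csubspace M \<longleftrightarrow> subspace M \<and> (\<lambda>x. \<i> *\<^sub>C x) ` M \<subseteq> M"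
proof
  assume M: "csubspace M"
  have "r *\<^sub>R x \<in> M" if "x \<in> M" for r x
    using complex_vector.subspace_scale[OF M that, of "complex_of_real r"]
    by (simp add: scaleC_of_real)
  then show "subspace M \<and> (\<lambda>x. \<i> *\<^sub>C x) ` M \<subseteq> M"
    using M by (auto simp: subspace_def complex_vector.subspace_def)
next
  assume M: "subspace M \<and> (\<lambda>x. \<i> *\<^sub>C x) ` M \<subseteq> M"
  then have "a *\<^sub>C x \<in> M" if "x \<in> M" for a x
    using that unfolding scaleC_decomp[of a] by (blast intro: subspace_add subspace_scale)
  then show "csubspace M"
    using M by (auto simp: subspace_def complex_vector.subspace_def)
qed

lemma csubspace_orth:
  fixes M :: "'a::complex_inner set"
  assumes M: "csubspace M"
  shows "csubspace (orth M)"
proof -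
  have "(\<i> *\<^sub>C x) \<bullet> y = 0" if "\<forall>z\<in>M. x \<bullet> z = 0" "y \<in> M" for x y
  proof -
    have "cnj \<i> *\<^sub>C y \<in> M" by (rule complex_vector.subspace_scale[OF M that(2)])
    with that(1) show ?thesis unfolding inner_scaleC_left by blast
  qed
  then show ?thesis
    by (auto simp: csubspace_iff subspace_orth) (simp add: orth_def)
qed

lemma ortho_compl_eq_orth:
  fixes M :: "'a::complex_inner set"
  assumes M: "csubspace M"
  shows "ortho_compl M = orth M"
proof -
  have "cinner x y = 0" if "x \<in> orth M" "y \<in> M" for x y
    using that complex_vector.subspace_scale[OF M that(2), of "\<i>"]
    by (simp add: cinner_eq_Complex orth_def complex_eq_iff)
  moreover have "x \<in> orth M" if "x \<in> ortho_compl M" for x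
    using that by (simp add: orth_def ortho_compl_def inner_eq_Re_cinner)
  ultimately show ?thesis by (auto simp: ortho_compl_def)
qed

lemma norm_attaining_on_iff:
  fixes T :: "'a::complex_inner \<Rightarrow> 'a"
  assumes T: "bounded_linear T" and M: "subspace M"
  shows "norm_attaining_on T M \<longleftrightarrow> attains_norm T M"
proof
  interpret T: bounded_linear T by fact
  {
    assume "norm_attaining_on T M"
    then obtain x where x: "x \<in> M" "norm x = 1" "norm (T x) = restr_norm T M"
      by (auto simp: norm_attaining_on_def)
    obtain k where k: "\<And>x. norm (T x) \<le> norm x * k"
      using T.bounded by blast
    have bdd: "bdd_above ((\<lambda>y. norm (T y)) ` {y \<in> M. norm y = 1})"
      using k by (intro bdd_aboveI2[of _ _ k]) (metis (mono_tags, lifting) mem_Collect_eq mult_1)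
    have "norm (T y) \<le> norm (T x) * norm y" if "y \<in> M" for y
    proof (cases "y = 0")
      case False
      then have "(1 / norm y) *\<^sub>R y \<in> {y \<in> M. norm y = 1}"
        using that M by (simp add: subspace_scale)
      then have "norm (T ((1 / norm y) *\<^sub>R y)) \<le> norm (T x)"
        unfolding x(3) restr_norm_def by (rule cSUP_upper[OF _ bdd])
      then show ?thesis using False by (simp add: T.scaleR field_simps)
    qed (simp add: T.zero)
    with x show "attains_norm T M" by (auto simp: attains_norm_def)
  }
  assume "attains_norm T M"
  then obtain x where x: "x \<in> M" "norm x = 1" "\<And>y. y \<in> M \<Longrightarrow> norm (T y) \<le> norm (T x) * norm y"
    by (auto simp: attains_norm_def)
  have "norm (T y) \<le> norm (T x)" if "y \<in> M" "norm y = 1" for y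
    using x(3)[OF that(1)] that(2) by simp
  with x have "restr_norm T M = norm (T x)"
    unfolding restr_norm_def by (intro cSup_eq_maximum) auto
  with x show "norm_attaining_on T M" by (auto simp: norm_attaining_on_def)
qed

text \<open>
  The complement of a hyperinvariant subspace of \<open>P\<close> is a reducing subspace in the complex sense. This
  is how membership in \<^const>\<open>beta\<close> enters the gap argument.
\<close>

lemma beta_attains_norm:
  assumes P: "P \<in> beta" "self_adjoint P" and N: "hyperinvariant P N" "orth N \<noteq> {0}"
  shows "attains_norm P (orth N)"
proof -
  have P_op: "P \<in> bounded_operators" using P(1) by (simp add: beta_def)
  have N': "subspace N" "closed N" and inv: "\<And>Y. bounded_linear Y \<Longrightarrow> commutes Y P \<Longrightarrow> Y ` N \<subseteq> N"
    using N(1) by (auto simp: hyperinvariant_def)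
  have "csubspace N"
    using N'(1) inv[OF bounded_linear_scaleC_right bounded_operatorsD(3)[OF P_op]]
    by (simp add: csubspace_iff)
  then have orth: "csubspace (orth N)" by (rule csubspace_orth)
  have PN: "P ` N \<subseteq> N"
    using bounded_operatorsD(1)[OF P_op] by (intro inv) (simp_all add: commutes_def)
  have "orth N \<in> reducing_subspaces P"
    using orth PN self_adjoint_orth_invariant[OF P(2) PN]
    by (simp add: reducing_subspaces_def ortho_compl_eq_orth orth_orth[OF N'] closed_orth)
  with P(1) N(2) have "norm_attaining_on P (orth N)" by (simp add: beta_def)
  then show ?thesis
    by (simp add: norm_attaining_on_iff[OF bounded_operatorsD(1)[OF P_op] subspace_orth])
qed

text \<open>
  A complex spanning set needs its multiples by \<open>\<i>\<close> added to test real orthogonality.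
\<close>

lemma finite_rank_range_orth:
  fixes K :: "'a::complex_inner \<Rightarrow> 'a"
  assumes "finite_rank K"
  obtains F where "finite F" "\<And>x y. (\<And>b. b \<in> F \<Longrightarrow> y \<bullet> b = 0) \<Longrightarrow> y \<bullet> K x = 0"
proof -
  obtain B where B: "finite B" "cspan B = range K"
    using assms by (auto simp: finite_rank_def cfinite_dim_def)
  let ?F = "B \<union> (\<lambda>b. \<i> *\<^sub>C b) ` B"
  show thesis
  proof (rule that)
    show "finite ?F" using B(1) by simp
    fix x y assume y: "\<And>b. b \<in> ?F \<Longrightarrow> y \<bullet> b = 0"
    have "csubspace {z. cinner z y = 0}"
      unfolding complex_vector.subspace_def
      by (auto simp: cinner_add_left cinner_scaleC_left cinner_eq_Complex[of 0] complex_eq_iff)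
    moreover have "B \<subseteq> {z. cinner z y = 0}"
    proof
      fix b assume b: "b \<in> B"
      then have "cinner y b = 0"
        using y[of b] y[of "\<i> *\<^sub>C b"] by (simp add: cinner_eq_Complex complex_eq_iff)
      then show "b \<in> {z. cinner z y = 0}"
        using cinner_commute[of b y] by simp
    qed
    ultimately have "cspan B \<subseteq> {z. cinner z y = 0}"
      by (rule complex_vector.span_minimal[rotated])
    then have "cinner (K x) y = 0" using B(2) by blast
    then show "y \<bullet> K x = 0"
      using inner_eq_Re_cinner[of "K x" y] by (simp add: inner_commute)
  qed
qed

text \<open>
  If \<open>x\<close> is in the kernel of \<open>K\<close> and \<open>S x\<close> is orthogonal to the range of \<open>K\<close>, then
  \<open>S x \<bullet> S z = T x \<bullet> T z\<close> for all \<open>z\<close>, so \<open>S\<^sup>* S\<close> and \<open>T\<^sup>* T\<close> agree at \<open>x\<close>. Both are finitely many linear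
  conditions on \<open>x\<close>, obtained by applying \<open>K\<^sup>*\<close> and \<open>S\<^sup>*\<close> to vectors that span the range of \<open>K\<close>.
\<close>

lemma abs_op_finite_rank_perturbation:
  fixes T K :: "'a::complex_hilbert_space \<Rightarrow> 'a"
  defines "S \<equiv> \<lambda>x. T x + K x"
  assumes T: "T \<in> bounded_operators" and K: "K \<in> bounded_operators" "finite_rank K"
    and S: "S \<in> bounded_operators"
  obtains F where "finite F"
    "\<And>x. (\<And>b. b \<in> F \<Longrightarrow> x \<bullet> b = 0) \<Longrightarrow> abs_op S (abs_op S x) = abs_op T (abs_op T x)"
proof -
  obtain F where F: "finite F" "\<And>x y. (\<And>b. b \<in> F \<Longrightarrow> y \<bullet> b = 0) \<Longrightarrow> y \<bullet> K x = 0"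
    by (rule finite_rank_range_orth[OF K(2)]) metis
  show thesis
  proof (rule that)
    show "finite (cadjoint K ` F \<union> cadjoint S ` F)" using F(1) by simp
    fix x assume x: "\<And>b. b \<in> cadjoint K ` F \<union> cadjoint S ` F \<Longrightarrow> x \<bullet> b = 0"
    have "K x \<bullet> K x = 0"
      by (rule F(2)) (use x cadjoint_props(2)[OF K(1)] in simp)
    then have Kx: "K x = 0" by simp
    have S_apply: "S z = T z + K z" for z by (simp add: S_def)
    have SK: "S x \<bullet> K z = 0" for z
      by (rule F(2)) (use x cadjoint_props(2)[OF S] in simp)
    have "z \<bullet> cadjoint S (S x) = z \<bullet> cadjoint T (T x)" for z
    proof -
      have "z \<bullet> cadjoint S (S x) = S x \<bullet> S z"
        using cadjoint_props(2)[OF S, of z "S x"] by (simp add: inner_commute)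
      also have "\<dots> = S x \<bullet> T z + S x \<bullet> K z"
        by (subst S_apply[of z]) (rule inner_add_right)
      also have "\<dots> = T z \<bullet> T x"
        by (simp add: SK) (simp add: S_apply Kx inner_commute)
      also have "\<dots> = z \<bullet> cadjoint T (T x)" by (rule cadjoint_props(2)[OF T])
      finally show ?thesis .
    qed
    then have "cadjoint S (S x) = cadjoint T (T x)"
      using vector_eq_ldot by blast
    then show "abs_op S (abs_op S x) = abs_op T (abs_op T x)"
      by (simp add: abs_op_props(3) S T)
  qed
qed

text \<open>
  The projection to a reducing subspace of \<open>S\<close> commutes with \<open>S\<^sup>* S\<close>, hence with its square root.
\<close>

lemma reducing_abs_op_invariant:
  fixes S :: "'a::complex_hilbert_space \<Rightarrow> 'a"
  assumes S: "S \<in> bounded_operators" and M: "M \<in> reducing_subspaces S"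
  shows "abs_op S ` M \<subseteq> M"
proof -
  let ?B = "\<lambda>x. cadjoint S (S x)"
  have cM: "csubspace M" "closed M"
    using M by (auto simp: reducing_subspaces_def)
  then have inv: "S ` M \<subseteq> M" "S ` orth M \<subseteq> orth M"
    using M by (simp_all add: reducing_subspaces_def ortho_compl_eq_orth)
  have sM: "subspace M" using cM(1) by (simp add: csubspace_iff)
  have "cadjoint S x \<in> orth M" if "x \<in> orth M" for x
  proof -
    have "S y \<bullet> x = 0" if "y \<in> M" for y
      using inv(1) that \<open>x \<in> orth M\<close> inner_commute[of x] by (fastforce simp: orth_def)
    then have "y \<bullet> cadjoint S x = 0" if "y \<in> M" for y
      using that by (simp flip: cadjoint_props(2)[OF S])
    then show ?thesis
      by (simp add: orth_def inner_commute[of "cadjoint S x"])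
  qed
  moreover have "cadjoint S x \<in> M" if "x \<in> M" for x
  proof -
    have "S y \<bullet> x = 0" if "y \<in> orth M" for y
      using inv(2) that \<open>x \<in> M\<close> by (auto simp: orth_def[of M])
    then have "y \<bullet> cadjoint S x = 0" if "y \<in> orth M" for y
      using that by (simp flip: cadjoint_props(2)[OF S])
    then have "cadjoint S x \<in> orth (orth M)"
      by (simp add: orth_def[of "orth M"] inner_commute[of "cadjoint S x"])
    then show ?thesis by (simp add: orth_orth sM cM(2))
  qed
  ultimately have B_inv: "?B ` M \<subseteq> M" "?B ` orth M \<subseteq> orth M"
    using inv by blast+
  obtain p where p: "self_adjoint p" "\<And>x. p x \<in> M" "\<And>x. x \<in> M \<Longrightarrow> p x = x"
    "\<And>Y. bounded_linear Y \<Longrightarrow> Y ` M \<subseteq> M \<Longrightarrow> Y ` orth M \<subseteq> orth M \<Longrightarrow> commutes Y p"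
    by (rule projection_exists[OF sM cM(2)]) metis
  have "bounded_linear ?B"
    using S cadjoint_props(1)[OF S] by (auto simp: bounded_operators_iff intro: bounded_linear_compose)
  then have "commutes ?B p" using B_inv by (rule p(4))
  then have "commutes p ?B" by (simp add: commutes_def)
  then have comm: "commutes p (abs_op S)"
    by (rule abs_op_props(5)[OF S self_adjointD(1)[OF p(1)]])
  show ?thesis
  proof
    fix y assume "y \<in> abs_op S ` M"
    then obtain x where "x \<in> M" "y = abs_op S x" by blast
    then have "p y = y" using comm p(3)[of x] by (simp add: commutes_def)
    then show "y \<in> M" using p(2)[of y] by simp
  qed
qed

theorem theorem4p3:
  fixes T K :: "'a::complex_hilbert_space \<Rightarrow> 'a"
  assumes "separable_space (euclidean :: 'a topology)"
    and "\<not> cfinite_dim (UNIV :: 'a set)"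
    and "T \<in> beta0"
    and "K \<in> bounded_operators"
    and "finite_rank K"
  shows "(\<lambda>x. T x + K x) \<in> beta0 \<and> (\<lambda>x. T x + K x) \<in> beta"
proof -
  define S where "S = (\<lambda>x. T x + K x)"
  have T: "T \<in> bounded_operators" "abs_op T \<in> beta"
    using assms(3) by (simp_all add: beta0_def)
  have S: "S \<in> bounded_operators"
    using T(1) assms(4)
    by (auto simp: S_def bounded_operators_iff scaleC_add_right intro: bounded_linear_add)
  obtain F where F: "finite F"
    "\<And>x. (\<And>b. b \<in> F \<Longrightarrow> x \<bullet> b = 0) \<Longrightarrow> abs_op S (abs_op S x) = abs_op T (abs_op T x)"
    by (rule abs_op_finite_rank_perturbation[OF T(1) assms(4,5) S[unfolded S_def], folded S_def]) metis
  have attains: "attains_norm (abs_op S) M"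
    if M: "subspace M" "closed M" "M \<noteq> {0}" "abs_op S ` M \<subseteq> M" for M
    using abs_op_props(2)[OF T(1)] beta_attains_norm[OF T(2) abs_op_props(2)[OF T(1)]] abs_op_props(2)[OF S] F M
    by (rule finite_codim_perturbation_attains_norm)
  have "norm_attaining_on (abs_op S) M" if M: "M \<in> reducing_subspaces (abs_op S)" "M \<noteq> {0}" for M
  proof -
    have "subspace M" "closed M" "abs_op S ` M \<subseteq> M"
      using M(1) by (auto simp: reducing_subspaces_def csubspace_iff)
    then show ?thesis
      using attains[OF _ _ M(2)] by (simp add: norm_attaining_on_iff bounded_operatorsD(1) abs_op_props(1) S)
  qed
  then have "S \<in> beta0"
    by (simp add: beta0_def beta_def S abs_op_props(1))
  moreover have "norm_attaining_on S M" if M: "M \<in> reducing_subspaces S" "M \<noteq> {0}" for M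
  proof -
    have sM: "subspace M" "closed M"
      using M(1) by (auto simp: reducing_subspaces_def csubspace_iff)
    have "attains_norm (abs_op S) M"
      by (rule attains[OF sM M(2) reducing_abs_op_invariant[OF S M(1)]])
    then have "attains_norm S M"
      by (simp add: attains_norm_def abs_op_props(4)[OF S])
    then show ?thesis
      using sM(1) by (simp add: norm_attaining_on_iff bounded_operatorsD(1) S)
  qed
  then have "S \<in> beta" by (simp add: beta_def S)
  ultimately show ?thesis by (simp add: S_def)
qed

end
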